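(* Let $q$ be a prime power, let $S\subseteq\mathbb F_q^n$ be a nonempty set with $h=\log_q|S|\ge1$, and let $0<\tau\le1$ and $0<\delta<1$. Set $$b=\left\lfloor h-1-\left\lceil\log_q(16h)\right\rceil-\log_q\frac{192}{\tau^2\delta}\right\rfloor.$$ If $b\ge1$, then a uniformly random linear map $L:\mathbb F_q^n\to\mathbb F_q^b$ is $\tau$-balanced with probability greater than $1-\delta$. The same conclusion holds for a uniformly random surjective linear map $\mathbb F_q^n\to\mathbb F_q^b$.
   Context: For nonempty $S\subseteq\mathbb F_q^n$ and $\mu=|S|/q^b$, a linear map $L:\mathbb F_q^n\to\mathbb F_q^b$ (not necessarily surjective) is called $\tau$-balanced (with respect to $S$) if $(1-\tau)\mu\le|S\cap L^{-1}(y)|\le(1+\tau)\mu$ for every $y\in\mathbb F_q^b$. *)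

theory Defs
  imports "HOL-Probability.Probability"
begin

text \<open>
  The field with \<open>q\<close> elements is a finite type \<open>'a\<close> of class \<open>field\<close>, so that \<open>q = CARD('a)\<close>; its
  coordinate spaces of dimension \<open>n\<close> and \<open>b\<close> are \<open>'a^'n\<close> and \<open>'a^'b\<close> with \<open>n = CARD('n)\<close> and
  \<open>b = CARD('b)\<close>.
\<close>

definition linear_maps :: "(('a::{field,finite})^'n \<Rightarrow> 'a^'b) set" where
  "linear_maps = {L. Vector_Spaces.linear (*s) (*s) L}"

definition surjective_linear_maps :: "(('a::{field,finite})^'n \<Rightarrow> 'a^'b) set" where
  "surjective_linear_maps = {L \<in> linear_maps. surj L}"

definition balanced :: "real \<Rightarrow> (('a::{field,finite})^'n) set \<Rightarrow> ('a^'n \<Rightarrow> 'a^'b) \<Rightarrow> bool" where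
  "balanced \<tau> S L \<longleftrightarrow>
    (let \<mu> = real (card S) / real CARD('a) ^ CARD('b)
     in \<forall>y. (1 - \<tau>) * \<mu> \<le> real (card (S \<inter> L -` {y})) \<and>
            real (card (S \<inter> L -` {y})) \<le> (1 + \<tau>) * \<mu>)"

end

theory Submission
  imports Defs "HOL-Computational_Algebra.Polynomial" "HOL-Library.Infinite_Typeclass"
begin

text \<open>
Write \<open>F\<close> for the field with \<open>q\<close> elements. Two distinct points of \<open>S\<close> collide under a
random linear map with probability only \<open>1 / q ^ b\<close>, which controls the second moment of the fibre sizes; but a
union bound over the \<open>q ^ b\<close> fibres would need far more than a second moment. The proof obtains the missing
uniformity from a Kakeya-type theorem.

Put \<open>k = \<lceil>log q (16 * h)\<rceil> + 1\<close> and \<open>m = b + k\<close>, so that \<open>m \<le> h\<close> and \<open>16 * m * q \<le> q ^ k\<close>. A uniform map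
\<open>L\<close> can be drawn as \<open>L x = U x - A (l x)\<close>, where \<open>(U, l)\<close> is a uniform linear map from \<open>F ^ n\<close> to
\<open>F ^ b \<times> F ^ k\<close> and \<open>A\<close> is an independent uniform linear map from \<open>F ^ k\<close> to \<open>F ^ b\<close>. The fibre of \<open>L\<close>
over \<open>y\<close> is the part of \<open>S\<close> that \<open>(U, l)\<close> maps into the flat \<open>{(y + A t, t) | t}\<close>, the graph of an
affine map. Let \<open>\<mu> = card S / q ^ m\<close> be the mean fibre size of \<open>(U, l)\<close>; the choice of \<open>b\<close> leaves
\<open>\<mu> \<ge> 192 / (\<tau>\<^sup>2 * \<delta>)\<close>. Now Chebyshev's inequality is enough, and it is used twice. First, the set \<open>B\<close> of
points whose \<open>(U, l)\<close>-fibre differs from \<open>\<mu>\<close> by at least \<open>\<tau> * \<mu> / 2\<close> has mean density of order at most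
\<open>\<delta>\<close>. Secondly, if \<open>L\<close> fails to be balanced at \<open>y\<close>, then, because \<open>l\<close> is independent of \<open>L\<close>, for
most \<open>l\<close> at least half of the flat over \<open>y\<close> lies in \<open>B\<close> (\<open>most_hashes_spread\<close>).

Suppose that \<open>L\<close> were unbalanced with probability at least \<open>\<delta>\<close>. Then a union of sets \<open>B\<close>, for finitely
many greedily chosen \<open>(U, l)\<close> (\<open>greedy_cover\<close>), has density at most \<open>1 / 20\<close>, and yet for at
least a quarter of all \<open>A\<close> it contains half of a flat with direction \<open>A\<close>. Lemma \<open>graph_kakeya\<close>
excludes this by the method of multiplicities. A count of coefficients gives a nonzero
polynomial of degree less than \<open>8 * m\<^sup>2 * q\<close> that vanishes to order \<open>8 * m\<^sup>2 + 8 * m\<close> on \<open>B\<close> and to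
order \<open>8 * m\<^sup>2 - 4 * m\<close> at all other points of \<open>F ^ m\<close>: changing an order by a factor \<open>1 + a / m\<close>
changes the number of conditions only by a factor of about \<open>exp a\<close>, so the conditions off \<open>B\<close> leave
room for those on the sparse set \<open>B\<close>. On a flat that lies half in \<open>B\<close> the average order is at least
\<open>8 * m\<^sup>2 + 2 * m\<close>, which exceeds \<open>degree / q\<close> with \<open>2 * m\<close> to spare. By the Schwartz-Zippel lemma with multiplicities, the
polynomial and its derivatives of order less than \<open>2 * m\<close> vanish identically on the flat. Their
leading coefficients in the generic direction of the flat then vanish as well, which says that the
top-degree form vanishes to order \<open>2 * m\<close> at that direction. The generic directions live over the ring
of univariate polynomials over \<open>F\<close>, and each of their \<open>b\<close> free coordinates takes \<open>q ^ k\<close> values, so a second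
application of the Schwartz-Zippel lemma, now in \<open>b\<close> variables, shows that the top-degree form
vanishes at every point with the same generic last \<open>k\<close> coordinates. But one of these points is generic in
all coordinates, and there a nonzero form does not vanish (\<open>kronecker_exponents\<close>).

Both halves of the theorem come from this result for \<open>min \<tau> (9 / 10)\<close> in place of \<open>\<tau>\<close>, for which the
constant 192 has enough slack: a map that is balanced with a parameter below 1 has no empty fibre and
is therefore surjective, so that passing to surjective maps only removes unbalanced ones.
\<close>

section \<open>Polynomial functions and their directional derivatives\<close>

instance poly :: (idom) infinite
proof
  have "inj (\<lambda>n. monom (1::'a) n)"
    by (rule injI) (metis degree_monom_eq zero_neq_one)
  then show "infinite (UNIV :: 'a poly set)"
    using finite_imageD[of "\<lambda>n. monom (1::'a) n" UNIV] finite_subset subset_UNIV by blast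
qed

lemma poly_eqI_infinite:
  fixes p q :: "'r::{idom,infinite} poly"
  assumes "\<And>T. poly p T = poly q T"
  shows "p = q"
proof (rule ccontr)
  assume "p \<noteq> q"
  then have "finite {T. poly (p - q) T = 0}" by (intro poly_roots_finite) auto
  moreover have "{T. poly (p - q) T = 0} = UNIV" using assms by auto
  ultimately show False using infinite_UNIV by metis
qed

abbreviation along :: "('i \<Rightarrow> 'r::comm_ring_1) \<Rightarrow> ('i \<Rightarrow> 'r) \<Rightarrow> 'r \<Rightarrow> 'i \<Rightarrow> 'r" where
  "along x v T \<equiv> (\<lambda>i. x i + T * v i)"

text \<open>
Polynomials in an arbitrary family of variables are treated as functions rather than coefficient
families: restriction to lines and flats is then composition, and over an infinite domain nothing is
lost. The index is a bound for the total degree.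
\<close>

inductive poly_fun :: "nat \<Rightarrow> (('i \<Rightarrow> 'r::comm_ring_1) \<Rightarrow> 'r) \<Rightarrow> bool" where
  const: "poly_fun d (\<lambda>x. r)"
| var: "poly_fun (Suc d) (\<lambda>x. x i)"
| add: "poly_fun d F \<Longrightarrow> poly_fun d G \<Longrightarrow> poly_fun d (\<lambda>x. F x + G x)"
| mult: "poly_fun d F \<Longrightarrow> poly_fun e G \<Longrightarrow> poly_fun (d + e) (\<lambda>x. F x * G x)"

lemma poly_fun_mono:
  assumes "poly_fun d F" "d \<le> e" shows "poly_fun e F"
  using poly_fun.mult[OF assms(1) poly_fun.const[of "e - d" 1]] assms(2) by simp

lemma poly_fun_sum:
  "(\<And>k. k \<in> K \<Longrightarrow> poly_fun d (f k)) \<Longrightarrow> poly_fun d (\<lambda>x. \<Sum>k\<in>K. f k x)"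
  by (induction K rule: infinite_finite_induct) (auto intro: poly_fun.const poly_fun.add)

lemma poly_fun_power: "poly_fun d F \<Longrightarrow> poly_fun (n * d) (\<lambda>x. F x ^ n)"
  by (induction n) (auto intro: poly_fun.const poly_fun.mult)

lemma poly_fun_prod:
  "(\<And>k. k \<in> K \<Longrightarrow> poly_fun (d k) (f k)) \<Longrightarrow> poly_fun (\<Sum>k\<in>K. d k) (\<lambda>x. \<Prod>k\<in>K. f k x)"
  by (induction K rule: infinite_finite_induct) (auto intro: poly_fun.const poly_fun.mult)

definition line :: "(('i \<Rightarrow> 'r::{idom,infinite}) \<Rightarrow> 'r) \<Rightarrow> ('i \<Rightarrow> 'r) \<Rightarrow> ('i \<Rightarrow> 'r) \<Rightarrow> 'r poly" where
  "line F x v = (THE p. \<forall>T. poly p T = F (along x v T))"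

text \<open>
The \<open>j\<close>-th Hasse derivative in the direction \<open>v\<close>, that is, the coefficient of \<open>T ^ j\<close> in
\<open>F (x + T * v)\<close>. Unlike iterated derivatives it keeps its meaning in positive characteristic.
\<close>

definition hasse :: "('i \<Rightarrow> 'r::{idom,infinite}) \<Rightarrow> nat \<Rightarrow> (('i \<Rightarrow> 'r) \<Rightarrow> 'r) \<Rightarrow> ('i \<Rightarrow> 'r) \<Rightarrow> 'r" where
  "hasse v j F x = coeff (line F x v) j"

lemma line_eqI:
  assumes "\<And>T. poly p T = F (along x v T)"
  shows "line F x v = p"
  unfolding line_def using assms by (intro the_equality) (auto intro!: poly_eqI_infinite)

lemma poly_fun_along:
  assumes "poly_fun d F"
  shows "\<exists>p. degree p \<le> d \<and> (\<forall>T. poly p T = F (along x v T))"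
  using assms
proof (induction rule: poly_fun.induct)
  case (const d r)
  then show ?case by (intro exI[of _ "[:r:]"]) auto
next
  case (var d i)
  then show ?case by (intro exI[of _ "[:x i, v i:]"]) auto
next
  case (add d F G)
  then obtain p q where "degree p \<le> d" "\<forall>T. poly p T = F (along x v T)"
    "degree q \<le> d" "\<forall>T. poly q T = G (along x v T)" by blast
  then show ?case by (intro exI[of _ "p + q"]) (auto intro: degree_add_le)
next
  case (mult d F e G)
  then obtain p q where "degree p \<le> d" "\<forall>T. poly p T = F (along x v T)"
    "degree q \<le> e" "\<forall>T. poly q T = G (along x v T)" by blast
  then show ?case
    by (intro exI[of _ "p * q"]) (auto intro: order.trans[OF degree_mult_le] add_mono)
qed

lemma poly_line:
  assumes "poly_fun d F"
  shows "poly (line F x v) T = F (along x v T)"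
  using poly_fun_along[OF assms, of x v] line_eqI[of _ F x v] by metis

lemma degree_line:
  assumes "poly_fun d F"
  shows "degree (line F x v) \<le> d"
  using poly_fun_along[OF assms, of x v] line_eqI[of _ F x v] by metis

lemma hasse_eq_0:
  assumes "poly_fun d F" "d < j"
  shows "hasse v j F x = 0"
  using degree_line[OF assms(1), of x v] assms(2) by (simp add: hasse_def coeff_eq_0)

lemma hasse_zero_order:
  assumes "poly_fun d F" shows "hasse v 0 F x = F x"
  using poly_line[OF assms, of x v 0] by (simp add: hasse_def poly_0_coeff_0)

lemma taylor:
  assumes "poly_fun d F"
  shows "F (along x v T) = (\<Sum>j\<le>d. hasse v j F x * T ^ j)"
proof -
  have "(\<Sum>j\<le>d. coeff (line F x v) j * T ^ j) = poly (line F x v) T"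
    unfolding poly_altdef using degree_line[OF assms, of x v]
    by (intro sum.mono_neutral_right) (auto simp: coeff_eq_0 not_le)
  then show ?thesis by (simp add: hasse_def poly_line[OF assms])
qed

lemma hasse_const: "hasse v j (\<lambda>x. r) x = (if j = 0 then r else 0)"
proof -
  have "line (\<lambda>x. r) x v = [:r:]" by (rule line_eqI) auto
  then show ?thesis by (simp add: hasse_def coeff_pCons split: nat.split)
qed

lemma hasse_var: "hasse v j (\<lambda>x. x i) x = (if j = 0 then x i else if j = 1 then v i else 0)"
proof -
  have "line (\<lambda>x. x i) x v = [:x i, v i:]" by (rule line_eqI) auto
  then show ?thesis by (simp add: hasse_def coeff_pCons split: nat.split)
qed

lemma hasse_add:
  assumes "poly_fun d F" "poly_fun e G"
  shows "hasse v j (\<lambda>x. F x + G x) x = hasse v j F x + hasse v j G x"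
proof -
  have "line (\<lambda>x. F x + G x) x v = line F x v + line G x v"
    by (rule line_eqI) (simp add: poly_line[OF assms(1)] poly_line[OF assms(2)])
  then show ?thesis by (simp add: hasse_def)
qed

lemma hasse_mult:
  assumes "poly_fun d F" "poly_fun e G"
  shows "hasse v j (\<lambda>x. F x * G x) x = (\<Sum>i\<le>j. hasse v i F x * hasse v (j - i) G x)"
proof -
  have "line (\<lambda>x. F x * G x) x v = line F x v * line G x v"
    by (rule line_eqI) (simp add: poly_line[OF assms(1)] poly_line[OF assms(2)])
  then show ?thesis by (simp add: hasse_def coeff_mult)
qed

lemma poly_fun_hasse:
  assumes "poly_fun d F"
  shows "poly_fun (d - j) (\<lambda>x. hasse v j F x)"
  using assms
proof (induction arbitrary: j rule: poly_fun.induct)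
  case (const d r)
  then show ?case by (simp add: hasse_const poly_fun.const)
next
  case (var d i)
  consider "j = 0" | "j = 1" | "j > 1" by linarith
  then show ?case by cases (simp_all add: hasse_var poly_fun.const poly_fun.var)
next
  case (add d F G)
  then show ?case by (simp add: hasse_add[OF add.hyps] poly_fun.add)
next
  case (mult d F e G)
  have "poly_fun (d + e - j) (\<lambda>x. hasse v i F x * hasse v (j - i) G x)" if "i \<le> j" for i
  proof (cases "i \<le> d \<and> j - i \<le> e")
    case True
    then have "d + e - j = (d - i) + (e - (j - i))" using that by auto
    then show ?thesis using poly_fun.mult[OF mult.IH(1)[of i] mult.IH(2)[of "j - i"]] by simp
  next
    case False
    then have "(\<lambda>x. hasse v i F x * hasse v (j - i) G x) = (\<lambda>x. 0)"
      using hasse_eq_0[OF mult.hyps(1)] hasse_eq_0[OF mult.hyps(2)] by (auto simp: not_le)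
    then show ?thesis by (simp add: poly_fun.const)
  qed
  then show ?case unfolding hasse_mult[OF mult.hyps] by (intro poly_fun_sum) auto
qed

text \<open>
Both sides are coefficients of the expansion of \<open>F\<close> in the plane through \<open>x\<close> spanned by \<open>r\<close> and \<open>v\<close>.
This identity replaces the calculus of mixed partial derivatives: it expresses derivatives in a
varying direction through iterated derivatives in two fixed ones.
\<close>

lemma hasse_plane:
  assumes "poly_fun d F"
  shows "hasse (along r v s) n F x = (\<Sum>j\<le>n. hasse r (n - j) (\<lambda>x. hasse v j F x) x * s ^ j)"
proof -
  define p where "p = (\<Sum>j\<le>d. smult (s ^ j) (monom 1 j * line (\<lambda>x. hasse v j F x) x r))"
  have "poly p T = F (along x (along r v s) T)" for T
  proof -
    have "F (along x (along r v s) T) = F (along (along x r T) v (s * T))"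
      by (simp add: algebra_simps)
    also have "\<dots> = (\<Sum>j\<le>d. hasse v j F (along x r T) * (s * T) ^ j)"
      by (rule taylor[OF assms])
    also have "\<dots> = poly p T"
      by (simp add: p_def poly_sum poly_monom poly_line[OF poly_fun_hasse[OF assms]]
          power_mult_distrib algebra_simps)
    finally show ?thesis by simp
  qed
  then have "line F x (along r v s) = p" by (rule line_eqI)
  then have "hasse (along r v s) n F x =
      (\<Sum>j\<le>d. s ^ j * (if n < j then 0 else hasse r (n - j) (\<lambda>x. hasse v j F x) x))"
    by (simp add: hasse_def p_def coeff_sum coeff_monom_mult cong: if_cong)
  also have "\<dots> = (\<Sum>j\<in>{..d}\<inter>{..n}. hasse r (n - j) (\<lambda>x. hasse v j F x) x * s ^ j)"
    by (rule sum.mono_neutral_cong_right) (auto simp: not_le mult.commute)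
  also have "\<dots> = (\<Sum>j\<le>n. hasse r (n - j) (\<lambda>x. hasse v j F x) x * s ^ j)"
  proof (rule sum.mono_neutral_left)
    show "\<forall>j\<in>{..n} - {..d} \<inter> {..n}. hasse r (n - j) (\<lambda>x. hasse v j F x) x * s ^ j = 0"
    proof
      fix j assume "j \<in> {..n} - {..d} \<inter> {..n}"
      then have "(\<lambda>x. hasse v j F x) = (\<lambda>x. 0)" using hasse_eq_0[OF assms] by auto
      then show "hasse r (n - j) (\<lambda>x. hasse v j F x) x * s ^ j = 0" by (simp add: hasse_const)
    qed
  qed auto
  finally show ?thesis .
qed

text \<open>
The expansion of \<open>F (x + S * r + T * v)\<close> can be computed in two orders, and its coefficients are unique
because the ring is infinite.
\<close>

lemma hasse_commute:
  assumes "poly_fun d F"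
  shows "hasse r i (\<lambda>x. hasse v j F x) x = hasse v j (\<lambda>x. hasse r i F x) x"
proof -
  have eq: "(\<Sum>j\<le>d. hasse v j F (along x r S) * T ^ j) = (\<Sum>i\<le>d. hasse r i F (along x v T) * S ^ i)"
    for S T
    unfolding taylor[OF assms, symmetric] by (simp add: algebra_simps)
  define P where "P S = (\<Sum>j\<le>d. monom (hasse v j F (along x r S)) j)" for S
  define Q where "Q S = (\<Sum>i\<le>d. smult (S ^ i) (line (\<lambda>x. hasse r i F x) x v))" for S
  have "P S = Q S" for S
  proof (rule poly_eqI_infinite)
    fix T
    show "poly (P S) T = poly (Q S) T"
      using eq[of S T] by (simp add: P_def Q_def poly_sum poly_monom
          poly_line[OF poly_fun_hasse[OF assms]] mult.commute)
  qed
  then have c: "coeff (P S) j = coeff (Q S) j" for S by simp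
  show ?thesis
  proof (cases "j \<le> d")
    case True
    have *: "hasse v j F (along x r S) = (\<Sum>i\<le>d. S ^ i * hasse v j (\<lambda>x. hasse r i F x) x)" for S
      using c[of S] True by (simp add: P_def Q_def coeff_sum hasse_def)
    define q where "q = (\<Sum>i\<le>d. monom (hasse v j (\<lambda>x. hasse r i F x) x) i)"
    have "line (\<lambda>x. hasse v j F x) x r = q"
      by (rule line_eqI) (simp add: * q_def poly_sum poly_monom mult.commute)
    then have *: "hasse r i (\<lambda>x. hasse v j F x) x =
        (if i \<le> d then hasse v j (\<lambda>x. hasse r i F x) x else 0)"
      by (simp add: hasse_def[of r] q_def coeff_sum)
    moreover have "(\<lambda>x. hasse r i F x) = (\<lambda>x. 0)" if "i > d"
      using hasse_eq_0[OF assms that] by auto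
    ultimately show ?thesis by (cases "i \<le> d") (auto simp: hasse_const)
  next
    case False
    then have "(\<lambda>x. hasse v j F x) = (\<lambda>x. 0)" using hasse_eq_0[OF assms] by auto
    moreover have "hasse v j (\<lambda>x. hasse r i F x) x = 0"
      using False by (intro hasse_eq_0[OF poly_fun_hasse[OF assms]]) auto
    ultimately show ?thesis by (simp add: hasse_const)
  qed
qed

text \<open>
The coefficient of degree \<open>d\<close> of \<open>F\<close> along a line depends only on the direction of the line, and as a
function of the direction it is a polynomial function itself.
\<close>

lemma top_form:
  assumes "poly_fun d F"
  shows "\<exists>H. poly_fun d H \<and> (\<forall>x v. hasse v d F x = H v)"
  using assms
proof (induction rule: poly_fun.induct)
  case (const d r)
  then show ?case
    by (intro exI[of _ "\<lambda>v. if d = 0 then r else 0"]) (auto simp: hasse_const poly_fun.const)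
next
  case (var d i)
  have "poly_fun (Suc d) (\<lambda>v. if d = 0 then v i else 0)"
    by (cases d) (simp_all add: poly_fun.var poly_fun.const)
  then show ?case
    by (intro exI[of _ "\<lambda>v. if d = 0 then v i else 0"]) (auto simp: hasse_var)
next
  case (add d F G)
  then obtain H H' where "poly_fun d H" "poly_fun d H'"
    "\<forall>x v. hasse v d F x = H v" "\<forall>x v. hasse v d G x = H' v" by blast
  then show ?case
    by (intro exI[of _ "\<lambda>v. H v + H' v"]) (auto simp: hasse_add[OF add.hyps] intro: poly_fun.add)
next
  case (mult d F e G)
  then obtain H H' where H: "poly_fun d H" "poly_fun e H'"
    "\<forall>x v. hasse v d F x = H v" "\<forall>x v. hasse v e G x = H' v" by blast
  have "hasse v (d + e) (\<lambda>x. F x * G x) x = H v * H' v" for x v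
  proof -
    have "hasse v (d + e) (\<lambda>x. F x * G x) x = (\<Sum>i\<in>{d}. hasse v i F x * hasse v (d + e - i) G x)"
      unfolding hasse_mult[OF mult.hyps]
    proof (rule sum.mono_neutral_right)
      show "\<forall>i\<in>{..d + e} - {d}. hasse v i F x * hasse v (d + e - i) G x = 0"
      proof
        fix i assume "i \<in> {..d + e} - {d}"
        then have "i > d \<or> d + e - i > e" by auto
        then show "hasse v i F x * hasse v (d + e - i) G x = 0"
          using hasse_eq_0[OF mult.hyps(1)] hasse_eq_0[OF mult.hyps(2)] by auto
      qed
    qed auto
    then show ?thesis using H(3,4) by simp
  qed
  then show ?case using H(1,2) by (intro exI[of _ "\<lambda>v. H v * H' v"]) (auto intro: poly_fun.mult)
qed

section \<open>Counting zeros with multiplicity\<close>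

text \<open>
The directions are restricted to \<open>W\<close> because the induction in
the Schwartz-Zippel lemma works on flats, where a function may vanish to a higher order than it does
in the whole space.
\<close>

definition vanish :: "('i \<Rightarrow> 'r::{idom,infinite}) set \<Rightarrow> nat \<Rightarrow> (('i \<Rightarrow> 'r) \<Rightarrow> 'r) \<Rightarrow> ('i \<Rightarrow> 'r) \<Rightarrow> bool" where
  "vanish W N F x \<longleftrightarrow> (\<forall>v\<in>W. \<forall>j<N. hasse v j F x = 0)"

lemma vanish_mono: "vanish W N F x \<Longrightarrow> W' \<subseteq> W \<Longrightarrow> vanish W' N F x"
  by (auto simp: vanish_def)

text \<open>
By \<open>hasse_plane\<close> the derivatives of order \<open>i + j < N\<close> of \<open>F\<close> in the directions \<open>r + s * v\<close> are
polynomials in \<open>s\<close>. They vanish for all \<open>s\<close>, hence so does each coefficient, and these coefficients are the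
iterated derivatives.
\<close>

lemma vanish_hasse:
  assumes "poly_fun d F" "vanish W N F x" "v \<in> W"
    and closed: "\<And>r s. r \<in> W \<Longrightarrow> along r v s \<in> W"
  shows "vanish W (N - j) (\<lambda>x. hasse v j F x) x"
  unfolding vanish_def
proof (intro ballI allI impI)
  fix r i assume r: "r \<in> W" and i: "i < N - j"
  define p where "p = (\<Sum>k\<le>i + j. monom (hasse r (i + j - k) (\<lambda>x. hasse v k F x) x) k)"
  have "poly p s = poly 0 s" for s
    using assms(2) closed[OF r, of s] i
    unfolding p_def poly_sum poly_monom hasse_plane[OF assms(1), symmetric] vanish_def by auto
  then have "coeff p j = 0" using poly_eqI_infinite[of p 0] by auto
  then show "hasse r i (\<lambda>x. hasse v j F x) x = 0" by (simp add: p_def coeff_sum)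
qed

definition comb :: "'k set \<Rightarrow> ('k \<Rightarrow> 'i \<Rightarrow> 'r::comm_ring_1) \<Rightarrow> ('k \<Rightarrow> 'r) \<Rightarrow> 'i \<Rightarrow> 'r" where
  "comb K v a = (\<lambda>i. \<Sum>l\<in>K. a l * v l i)"

definition flat_pt :: "('i \<Rightarrow> 'r::comm_ring_1) \<Rightarrow> 'k set \<Rightarrow> ('k \<Rightarrow> 'i \<Rightarrow> 'r) \<Rightarrow> ('k \<Rightarrow> 'r) \<Rightarrow> 'i \<Rightarrow> 'r" where
  "flat_pt x K v a = (\<lambda>i. x i + comb K v a i)"

lemma comb_insert:
  assumes "finite K" "l \<notin> K"
  shows "comb (insert l K) v a = along (comb K v a) (v l) (a l)"
  using assms by (auto simp: comb_def add.commute)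

lemma flat_insert:
  assumes "finite K" "l \<notin> K"
  shows "flat_pt x (insert l K) v a = along (flat_pt x K v a) (v l) (a l)"
  using assms by (auto simp: flat_pt_def comb_def algebra_simps)

lemma along_comb: "along (comb K v a) (comb K v b) s = comb K v (\<lambda>l. a l + s * b l)"
  by (auto simp: comb_def sum.distrib sum_distrib_left algebra_simps)

lemma along_flat: "along (flat_pt x K v a) (comb K v b) s = flat_pt x K v (\<lambda>l. a l + s * b l)"
  by (auto simp: flat_pt_def comb_def sum.distrib sum_distrib_left algebra_simps)

lemma comb_cong: "(\<And>l. l \<in> K \<Longrightarrow> a l = b l) \<Longrightarrow> comb K v a = comb K v b"
  by (auto simp: comb_def intro!: ext sum.cong)

lemma flat_cong: "(\<And>l. l \<in> K \<Longrightarrow> a l = b l) \<Longrightarrow> flat_pt x K v a = flat_pt x K v b"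
  by (simp add: flat_pt_def comb_cong[of K a b])

lemma sum_multiplicities_le_degree:
  fixes p :: "'r::idom poly" and g :: "'c \<Rightarrow> 'r"
  assumes "p \<noteq> 0" "finite A" "inj_on g A"
    and "\<And>b. b \<in> A \<Longrightarrow> [:- g b, 1:] ^ n b dvd p"
  shows "(\<Sum>b\<in>A. n b) \<le> degree p"
proof -
  have fin: "finite {x. poly p x = 0}" using assms(1) by (rule poly_roots_finite)
  have "(\<Sum>b\<in>A. n b) \<le> (\<Sum>b\<in>A. order (g b) p)"
    using assms(1,4) by (intro sum_mono) (simp add: order_divides)
  also have "\<dots> = (\<Sum>x\<in>g ` A. order x p)"
    using assms(3) by (simp add: sum.reindex)
  also have "\<dots> = (\<Sum>x\<in>g ` A \<inter> {x. poly p x = 0}. order x p)"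
    using assms(2) by (intro sum.mono_neutral_right) (auto simp: order_0I)
  also have "\<dots> \<le> (\<Sum>x | poly p x = 0. order x p)"
    using fin by (intro sum_mono2) auto
  also have "\<dots> \<le> degree p" by (rule sum_order_le_degree[OF assms(1)])
  finally show ?thesis .
qed

lemma linear_power_dvd_if_taylor:
  fixes p :: "'r::{idom,infinite} poly"
  assumes "\<And>T. poly q T = poly p (b + T)" "\<And>i. i < n \<Longrightarrow> coeff q i = 0"
  shows "[:- b, 1:] ^ n dvd p"
proof -
  have "monom 1 n dvd q" using assms(2) by (simp add: monom_1_dvd_iff')
  then obtain r where r: "q = monom 1 n * r" by (elim dvdE)
  have "p = [:- b, 1:] ^ n * pcompose r [:- b, 1:]"
  proof (rule poly_eqI_infinite)
    fix T
    have "poly p T = poly q (T - b)" using assms(1)[of "T - b"] by simp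
    then show "poly p T = poly ([:- b, 1:] ^ n * pcompose r [:- b, 1:]) T"
      by (simp add: r poly_pcompose poly_monom algebra_simps)
  qed
  then show ?thesis by simp
qed

lemma sum_PiE_insert:
  assumes "l \<notin> K"
  shows "(\<Sum>a\<in>PiE (insert l K) (\<lambda>_. A). f a) = (\<Sum>a\<in>PiE K (\<lambda>_. A). \<Sum>b\<in>A. f (a(l := b)))"
proof -
  have inj: "inj_on (\<lambda>(y, g). g(l := y)) (A \<times> PiE K (\<lambda>_. A))"
    using assms by (intro inj_onI) (auto simp: PiE_def extensional_def fun_eq_iff split: if_splits, metis+)
  have "(\<Sum>a\<in>PiE (insert l K) (\<lambda>_. A). f a) = (\<Sum>(b, a)\<in>A \<times> PiE K (\<lambda>_. A). f (a(l := b)))"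
    unfolding PiE_insert_eq by (subst sum.reindex[OF inj]) (simp add: o_def case_prod_unfold)
  also have "\<dots> = (\<Sum>b\<in>A. \<Sum>a\<in>PiE K (\<lambda>_. A). f (a(l := b)))"
    by (rule sum.cartesian_product[symmetric])
  also have "\<dots> = (\<Sum>a\<in>PiE K (\<lambda>_. A). \<Sum>b\<in>A. f (a(l := b)))" by (rule sum.swap)
  finally show ?thesis .
qed

text \<open>
The Schwartz-Zippel lemma with multiplicities of Dvir, Kopparty, Saraf and Sudan, for a grid on a
flat. In the last coordinate \<open>F\<close> is a polynomial of some degree \<open>t\<close> with coefficients
\<open>G j\<close>, and \<open>G t\<close> has degree at most \<open>d - t\<close>. Over a point \<open>a\<close> of the smaller grid where \<open>G t\<close> vanishes to order
exactly \<open>m a\<close>, a suitable derivative of \<open>F\<close> of order \<open>m a\<close> restricts to a nonzero univariate polynomial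
of degree \<open>t\<close>. The orders of vanishing of \<open>F\<close> on the fibre over \<open>a\<close> drop by at most \<open>m a\<close> each, so they add up to at
most \<open>t + card A * m a\<close>; the induction hypothesis bounds the sum of the \<open>m a\<close>.
\<close>

lemma schwartz_zippel_multiplicity:
  fixes F :: "('i \<Rightarrow> 'r::{idom,infinite}) \<Rightarrow> 'r" and g :: "'c \<Rightarrow> 'r"
  assumes "finite K" "finite A" "inj_on g A" "poly_fun d F" "F (flat_pt x K v s) \<noteq> 0"
    and "\<And>a. a \<in> PiE K (\<lambda>_. A) \<Longrightarrow> vanish (range (comb K v)) (\<mu> a) F (flat_pt x K v (\<lambda>l. g (a l)))"
  shows "card A * (\<Sum>a\<in>PiE K (\<lambda>_. A). \<mu> a) \<le> d * card A ^ card K"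
  using assms(1,4-6)
proof (induction K arbitrary: d F s \<mu> rule: finite_induct)
  case empty
  let ?u = "\<lambda>_::'k. undefined :: 'c"
  have "\<not> 0 < \<mu> ?u"
  proof
    assume "0 < \<mu> ?u"
    then have "hasse (comb {} v s) 0 F (flat_pt x {} v (\<lambda>l. g (?u l))) = 0"
      using empty(3)[of ?u] by (auto simp: vanish_def)
    then show False
      using empty(2) by (simp add: hasse_zero_order[OF empty(1)] flat_pt_def comb_def)
  qed
  then show ?case by simp
next
  case (insert l K)
  define G where "G j = (\<lambda>y. hasse (v l) j F y)" for j
  have polyG: "poly_fun (d - j) (G j)" for j
    unfolding G_def by (rule poly_fun_hasse[OF insert.prems(1)])
  define J where "J = {j. \<exists>s. G j (flat_pt x K v s) \<noteq> 0}"
  have J_le: "j \<le> d" if "j \<in> J" for j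
    using that hasse_eq_0[OF insert.prems(1)] unfolding J_def G_def by (auto simp: not_le[symmetric])
  then have finJ: "finite J" by (meson finite_nat_set_iff_bounded_le)
  have "J \<noteq> {}"
  proof
    assume "J = {}"
    then have "G j (flat_pt x K v s) = 0" for j by (auto simp: J_def)
    then have "F (along (flat_pt x K v s) (v l) (s l)) = 0"
      by (simp add: taylor[OF insert.prems(1)] G_def)
    then show False using insert.prems(2) insert.hyps by (simp add: flat_insert)
  qed
  \<comment> \<open>the degree of \<open>F\<close> in the new coordinate, over the flat spanned by the others\<close>
  define t where "t = Max J"
  have t: "t \<in> J" "\<And>j. t < j \<Longrightarrow> j \<notin> J"
    using Max_in[OF finJ \<open>J \<noteq> {}\<close>] Max_ge[OF finJ] by (auto simp: t_def leD)
  have td: "t \<le> d" using J_le t(1) by blast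
  obtain s0 where s0: "G t (flat_pt x K v s0) \<noteq> 0" using t(1) by (auto simp: J_def)
  have zero: "G j (flat_pt x K v s') = 0" if "t < j" for j s' using t(2)[OF that] by (auto simp: J_def)
  let ?pt = "\<lambda>a. flat_pt x K v (\<lambda>l. g (a l))"
  define Q where "Q a m \<longleftrightarrow> (\<exists>c. hasse (comb K v c) m (G t) (?pt a) \<noteq> 0)" for a m
  define m where "m a = (LEAST j. Q a j)" for a
  have Qm: "Q a (m a)" for a
  proof -
    have "\<exists>j. Q a j"
    proof (rule ccontr)
      assume "\<not> (\<exists>j. Q a j)"
      then have "hasse (comb K v (\<lambda>l. s0 l - g (a l))) j (G t) (?pt a) = 0" for j
        by (auto simp: Q_def)
      then have "G t (along (?pt a) (comb K v (\<lambda>l. s0 l - g (a l))) 1) = 0"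
        unfolding taylor[OF polyG] by simp
      moreover have "along (?pt a) (comb K v (\<lambda>l. s0 l - g (a l))) 1 = flat_pt x K v s0"
        unfolding along_flat by simp
      ultimately show False using s0 by metis
    qed
    then show ?thesis unfolding m_def by (rule LeastI_ex)
  qed
  have IH: "card A * (\<Sum>a\<in>PiE K (\<lambda>_. A). m a) \<le> (d - t) * card A ^ card K"
  proof (rule insert.IH[OF polyG s0])
    fix a
    show "vanish (range (comb K v)) (m a) (G t) (?pt a)"
      unfolding vanish_def
    proof (intro ballI allI impI)
      fix w j assume "w \<in> range (comb K v)" "j < m a"
      moreover from this have "\<not> Q a j" unfolding m_def by (intro not_less_Least)
      ultimately show "hasse w j (G t) (?pt a) = 0" by (auto simp: Q_def)
    qed
  qed
  have fibre: "(\<Sum>b\<in>A. \<mu> (a(l := b))) \<le> t + card A * m a" if a: "a \<in> PiE K (\<lambda>_. A)" for a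
  proof -
    \<comment> \<open>The direction must lie in the small flat: only there do the coefficients beyond \<open>t\<close> vanish.\<close>
    obtain c where c: "hasse (comb K v c) (m a) (G t) (?pt a) \<noteq> 0" using Qm by (auto simp: Q_def)
    let ?r = "comb K v c"
    define E where "E = (\<lambda>y. hasse ?r (m a) F y)"
    have polyE: "poly_fun (d - m a) E" unfolding E_def by (rule poly_fun_hasse[OF insert.prems(1)])
    define p where "p = line E (?pt a) (v l)"
    have coeff_p: "coeff p j = hasse ?r (m a) (G j) (?pt a)" for j
      unfolding p_def G_def E_def hasse_def[symmetric] by (rule hasse_commute[OF insert.prems(1), symmetric])
    have "p \<noteq> 0" using c coeff_p[of t] by auto
    have "degree p \<le> t"
    proof (rule degree_le, intro allI impI)
      fix j assume "t < j"
      then have "line (G j) (?pt a) ?r = 0" by (intro line_eqI) (simp add: along_flat zero)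
      then show "coeff p j = 0" by (simp add: coeff_p hasse_def)
    qed
    have "[:- g b, 1:] ^ (\<mu> (a(l := b)) - m a) dvd p" if b: "b \<in> A" for b
    proof (rule linear_power_dvd_if_taylor)
      let ?z = "along (?pt a) (v l) (g b)"
      show "poly (line E ?z (v l)) T = poly p (g b + T)" for T
        by (simp add: p_def poly_line[OF polyE] algebra_simps)
      fix i assume i: "i < \<mu> (a(l := b)) - m a"
      let ?W = "range (comb (insert l K) v)"
      have mem: "a(l := b) \<in> PiE (insert l K) (\<lambda>_. A)"
        by (rule PiE_fun_upd[OF b a])
      have z: "flat_pt x (insert l K) v (\<lambda>j. g ((a(l := b)) j)) = ?z"
      proof -
        have "flat_pt x K v (\<lambda>j. g ((a(l := b)) j)) = ?pt a"
          using insert.hyps by (intro flat_cong) auto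
        then show ?thesis by (simp add: flat_insert[OF insert.hyps])
      qed
      have r: "?r \<in> ?W"
      proof -
        have "?r = comb (insert l K) v (c(l := 0))"
        proof -
          have "comb K v (c(l := 0)) = ?r" using insert.hyps by (intro comb_cong) auto
          then show ?thesis by (simp add: comb_insert[OF insert.hyps])
        qed
        then show ?thesis by blast
      qed
      have vl: "v l \<in> ?W"
      proof -
        have "v l = comb (insert l K) v (\<lambda>j. if j = l then 1 else 0)"
        proof -
          have "comb K v (\<lambda>j. if j = l then 1 else 0) = (\<lambda>i. 0)"
            using insert.hyps by (auto simp: comb_def intro!: ext sum.neutral)
          then show ?thesis by (simp add: comb_insert[OF insert.hyps])
        qed
        then show ?thesis by blast
      qed
      have "vanish ?W (\<mu> (a(l := b)) - m a) E ?z"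
        unfolding E_def
      proof (rule vanish_hasse[OF insert.prems(1) _ r])
        show "vanish ?W (\<mu> (a(l := b))) F ?z" using insert.prems(3)[OF mem] unfolding z .
        show "along r' ?r s' \<in> ?W" if "r' \<in> ?W" for r' s'
          using that r by (auto simp: along_comb)
      qed
      then show "coeff (line E ?z (v l)) i = 0" using vl i by (auto simp: vanish_def hasse_def)
    qed
    then have "(\<Sum>b\<in>A. \<mu> (a(l := b)) - m a) \<le> degree p"
      by (intro sum_multiplicities_le_degree[OF \<open>p \<noteq> 0\<close> assms(2,3)])
    moreover have "(\<Sum>b\<in>A. \<mu> (a(l := b))) \<le> (\<Sum>b\<in>A. (\<mu> (a(l := b)) - m a) + m a)"
      by (intro sum_mono) auto
    ultimately show ?thesis using \<open>degree p \<le> t\<close> by (simp add: sum.distrib)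
  qed
  have cardP: "card (PiE K (\<lambda>_. A)) = card A ^ card K"
    using insert.hyps by (simp add: card_PiE)
  have "(\<Sum>a\<in>PiE (insert l K) (\<lambda>_. A). \<mu> a) = (\<Sum>a\<in>PiE K (\<lambda>_. A). \<Sum>b\<in>A. \<mu> (a(l := b)))"
    by (rule sum_PiE_insert[OF insert.hyps(2)])
  also have "\<dots> \<le> (\<Sum>a\<in>PiE K (\<lambda>_. A). t + card A * m a)" by (intro sum_mono fibre)
  also have "\<dots> = t * card A ^ card K + card A * (\<Sum>a\<in>PiE K (\<lambda>_. A). m a)"
    by (simp add: sum.distrib cardP sum_distrib_left mult.commute)
  also have "\<dots> \<le> t * card A ^ card K + (d - t) * card A ^ card K" using IH by simp
  also have "\<dots> = d * card A ^ card K" using td by (simp add: distrib_right[symmetric])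
  finally have "(\<Sum>a\<in>PiE (insert l K) (\<lambda>_. A). \<mu> a) \<le> d * card A ^ card K" .
  from mult_left_mono[OF this, of "card A"] show ?case
    using insert.hyps by (simp add: mult_ac)
qed

section \<open>Polynomials with prescribed vanishing orders\<close>

text \<open>
Exponent vectors are extensional functions because expanding a product of sums yields exactly this
kind of index.
\<close>

definition exps :: "'i set \<Rightarrow> nat \<Rightarrow> ('i \<Rightarrow> nat) set" where
  "exps I n = {e \<in> PiE I (\<lambda>_. UNIV). sum e I < n}"

lemma exps_lt: "finite I \<Longrightarrow> e \<in> exps I n \<Longrightarrow> i \<in> I \<Longrightarrow> e i < n"
  using member_le_sum[of i I e] by (auto simp: exps_def)

lemma finite_exps: assumes "finite I" shows "finite (exps I n)"
proof -
  have "exps I n \<subseteq> PiE I (\<lambda>_. {..<n})"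
  proof
    fix e assume e: "e \<in> exps I n"
    then show "e \<in> PiE I (\<lambda>_. {..<n})"
      using exps_lt[OF assms e] by (simp add: exps_def PiE_iff)
  qed
  then show ?thesis using assms finite_PiE[of I "\<lambda>_. {..<n}"] finite_subset by auto
qed

lemma card_exps:
  assumes "finite I"
  shows "card (exps I (Suc n)) = (n + card I) choose card I"
  using assms
proof (induction I arbitrary: n rule: finite_induct)
  case empty
  have "exps {} (Suc n) = {\<lambda>_. undefined}" by (auto simp: exps_def)
  then show ?case unfolding \<open>exps {} (Suc n) = _\<close> by simp
next
  case (insert i I)
  let ?f = "\<lambda>(j, e). e(i := j)"
  let ?S = "SIGMA j:{..n}. exps I (Suc (n - j))"
  have s: "sum (e(i := j)) I = sum e I" for e and j :: nat
    using insert.hyps by (intro sum.cong) auto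
  have inj: "inj_on ?f ?S"
    using insert.hyps
    by (intro inj_onI) (auto simp: exps_def PiE_def extensional_def fun_eq_iff split: if_splits, metis+)
  have img: "exps (insert i I) (Suc n) = ?f ` ?S"
  proof (intro equalityI subsetI)
    fix e assume e: "e \<in> exps (insert i I) (Suc n)"
    then have *: "e i + sum e I \<le> n" using insert.hyps by (simp add: exps_def)
    let ?e = "e(i := undefined)"
    have "?e \<in> exps I (Suc (n - e i))"
      using e * insert.hyps s[of e undefined] by (auto simp: exps_def PiE_def extensional_def)
    moreover have "e = ?f (e i, ?e)" by simp
    ultimately show "e \<in> ?f ` ?S" using * by (intro image_eqI[of _ _ "(e i, ?e)"]) auto
  next
    fix e assume "e \<in> ?f ` ?S"
    then obtain j e' where je: "e = e'(i := j)" "j \<le> n" "e' \<in> exps I (Suc (n - j))" by auto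
    then have "sum e (insert i I) < Suc n"
      using insert.hyps s[of e' j] by (auto simp: exps_def)
    then show "e \<in> exps (insert i I) (Suc n)"
      using je by (auto simp: exps_def PiE_def extensional_def)
  qed
  have "card (exps (insert i I) (Suc n)) = card ?S" unfolding img by (rule card_image[OF inj])
  also have "\<dots> = (\<Sum>j\<le>n. (n - j + card I) choose card I)"
    using finite_exps[OF insert.hyps(1)] by (simp add: insert.IH)
  also have "\<dots> = (\<Sum>j\<le>n. (card I + j) choose j)"
  proof (rule sum.reindex_bij_witness[of _ "\<lambda>j. n - j" "\<lambda>j. n - j"])
    fix j
    show "(card I + (n - j)) choose (n - j) = (n - j + card I) choose card I"
      using binomial_symmetric[of "n - j" "card I + (n - j)"] by (simp add: add.commute)
  qed auto
  also have "\<dots> = Suc (card I + n) choose n" by (rule sum_choose_lower)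
  also have "\<dots> = (n + card (insert i I)) choose card (insert i I)"
    using insert.hyps binomial_symmetric[of n "Suc (card I + n)"]
    by (simp add: add.commute del: binomial_Suc_Suc)
  finally show ?case .
qed

text \<open>
The polynomial with coefficients \<open>c\<close> over the base field, evaluated at arguments in the ring of univariate
polynomials over it, which serves as an infinite extension domain.
\<close>

definition eval_poly :: "'i set \<Rightarrow> nat \<Rightarrow> (('i \<Rightarrow> nat) \<Rightarrow> 'a::idom) \<Rightarrow> ('i \<Rightarrow> 'a poly) \<Rightarrow> 'a poly" where
  "eval_poly I n c X = (\<Sum>e\<in>exps I n. [:c e:] * (\<Prod>i\<in>I. X i ^ e i))"

lemma poly_fun_eval_poly:
  assumes "\<And>e. e \<in> exps I n \<Longrightarrow> c e \<noteq> 0 \<Longrightarrow> sum e I \<le> d"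
  shows "poly_fun d (eval_poly I n c)"
  unfolding eval_poly_def
proof (rule poly_fun_sum)
  fix e assume e: "e \<in> exps I n"
  show "poly_fun d (\<lambda>X. [:c e:] * (\<Prod>i\<in>I. X i ^ e i))"
  proof (cases "c e = 0")
    case False
    have "poly_fun (0 + (\<Sum>i\<in>I. e i * Suc 0)) (\<lambda>X::'a \<Rightarrow> 'b poly. [:c e:] * (\<Prod>i\<in>I. X i ^ e i))"
      by (intro poly_fun.mult poly_fun.const poly_fun_prod poly_fun_power poly_fun.var)
    then show ?thesis using assms[OF e False] by (auto intro: poly_fun_mono)
  qed (simp add: poly_fun.const)
qed

text \<open>
The coefficient of \<open>Y\<close> to the power \<open>\<alpha>\<close> in the Taylor expansion at \<open>z + Y\<close>.
\<close>

definition jet :: "'i set \<Rightarrow> nat \<Rightarrow> (('i \<Rightarrow> nat) \<Rightarrow> 'a::idom) \<Rightarrow> ('i \<Rightarrow> 'a) \<Rightarrow> ('i \<Rightarrow> nat) \<Rightarrow> 'a" where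
  "jet I n c z \<alpha> = (\<Sum>e\<in>exps I n. c e * (\<Prod>i\<in>I. of_nat (e i choose \<alpha> i) * z i ^ (e i - \<alpha> i)))"

lemma const_poly_prod: "(\<Prod>i\<in>I. [:f i:]) = [:\<Prod>i\<in>I. f i:]"
  by (induction I rule: infinite_finite_induct) (auto simp: one_pCons mult.commute)

lemma const_poly_sum: "(\<Sum>i\<in>I. [:f i:]) = [:\<Sum>i\<in>I. f i:]"
  by (induction I rule: infinite_finite_induct) auto

lemma const_poly_power: "[:a:] ^ n = [:a ^ n:]"
  by (induction n) (auto simp: one_pCons mult.commute)

lemma const_poly_of_nat: "of_nat n = [:of_nat n:]"
  by (simp add: of_nat_poly)

lemma eval_poly_along:
  assumes "finite I"
  shows "eval_poly I n c (along (\<lambda>i. [:z i:]) v T) =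
    (\<Sum>\<alpha>\<in>exps I n. [:jet I n c z \<alpha>:] * (\<Prod>i\<in>I. v i ^ \<alpha> i) * T ^ sum \<alpha> I)"
proof -
  have mono: "(\<Prod>i\<in>I. ([:z i:] + T * v i) ^ e i) =
     (\<Sum>\<alpha>\<in>exps I n. [:\<Prod>i\<in>I. of_nat (e i choose \<alpha> i) * z i ^ (e i - \<alpha> i):] * (\<Prod>i\<in>I. v i ^ \<alpha> i) * T ^ sum \<alpha> I)"
    if e: "e \<in> exps I n" for e
  proof -
    let ?h = "\<lambda>\<alpha>. \<Prod>i\<in>I. of_nat (e i choose \<alpha> i) * (T * v i) ^ \<alpha> i * [:z i:] ^ (e i - \<alpha> i)"
    have "(\<Prod>i\<in>I. ([:z i:] + T * v i) ^ e i) = (\<Prod>i\<in>I. \<Sum>a\<le>e i. of_nat (e i choose a) * (T * v i) ^ a * [:z i:] ^ (e i - a))"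
      by (intro prod.cong refl) (simp add: add.commute[of "[:z _:]"] binomial_ring)
    also have "\<dots> = (\<Sum>\<alpha>\<in>PiE I (\<lambda>i. {..e i}). ?h \<alpha>)"
      by (rule prod_sum_PiE) (use assms in auto)
    also have "\<dots> = (\<Sum>\<alpha>\<in>exps I n. ?h \<alpha>)"
    proof (rule sum.mono_neutral_left)
      show "finite (exps I n)" by (rule finite_exps[OF assms])
      show "PiE I (\<lambda>i. {..e i}) \<subseteq> exps I n"
      proof
        fix \<alpha> assume a: "\<alpha> \<in> PiE I (\<lambda>i. {..e i})"
        then have "sum \<alpha> I \<le> sum e I" by (intro sum_mono) auto
        then show "\<alpha> \<in> exps I n" using a e by (auto simp: exps_def PiE_iff)
      qed
      show "\<forall>\<alpha>\<in>exps I n - PiE I (\<lambda>i. {..e i}). ?h \<alpha> = 0"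
      proof
        fix \<alpha> assume "\<alpha> \<in> exps I n - PiE I (\<lambda>i. {..e i})"
        then obtain i where "i \<in> I" "e i < \<alpha> i" by (auto simp: exps_def PiE_iff not_le)
        then show "?h \<alpha> = 0" using assms by (intro prod_zero) (auto intro!: bexI[of _ i] simp: binomial_eq_0)
      qed
    qed
    also have "\<dots> = (\<Sum>\<alpha>\<in>exps I n. [:\<Prod>i\<in>I. of_nat (e i choose \<alpha> i) * z i ^ (e i - \<alpha> i):] * (\<Prod>i\<in>I. v i ^ \<alpha> i) * T ^ sum \<alpha> I)"
    proof (intro sum.cong refl)
      fix \<alpha>
      have "[:\<Prod>i\<in>I. of_nat (e i choose \<alpha> i) * z i ^ (e i - \<alpha> i):] =
          (\<Prod>i\<in>I. of_nat (e i choose \<alpha> i) * [:z i:] ^ (e i - \<alpha> i))"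
        unfolding const_poly_prod[symmetric]
        by (intro prod.cong refl) (simp add: const_poly_of_nat const_poly_power)
      then show "?h \<alpha> = [:\<Prod>i\<in>I. of_nat (e i choose \<alpha> i) * z i ^ (e i - \<alpha> i):] * (\<Prod>i\<in>I. v i ^ \<alpha> i) * T ^ sum \<alpha> I"
        by (simp only: prod.distrib power_mult_distrib power_sum mult_ac)
    qed
    finally show ?thesis .
  qed
  have "eval_poly I n c (along (\<lambda>i. [:z i:]) v T) =
     (\<Sum>e\<in>exps I n. \<Sum>\<alpha>\<in>exps I n. [:c e * (\<Prod>i\<in>I. of_nat (e i choose \<alpha> i) * z i ^ (e i - \<alpha> i)):] * ((\<Prod>i\<in>I. v i ^ \<alpha> i) * T ^ sum \<alpha> I))"
    unfolding eval_poly_def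
  proof (intro sum.cong refl)
    fix e assume e: "e \<in> exps I n"
    have "[:c e * a:] * y = [:c e:] * ([:a:] * y)" for a y by (simp add: mult.commute)
    then show "[:c e:] * (\<Prod>i\<in>I. ([:z i:] + T * v i) ^ e i) =
        (\<Sum>\<alpha>\<in>exps I n. [:c e * (\<Prod>i\<in>I. of_nat (e i choose \<alpha> i) * z i ^ (e i - \<alpha> i)):] * ((\<Prod>i\<in>I. v i ^ \<alpha> i) * T ^ sum \<alpha> I))"
      unfolding mono[OF e] sum_distrib_left by (simp only: mult.assoc)
  qed
  also have "\<dots> = (\<Sum>\<alpha>\<in>exps I n. [:jet I n c z \<alpha>:] * ((\<Prod>i\<in>I. v i ^ \<alpha> i) * T ^ sum \<alpha> I))"
    by (subst sum.swap) (simp only: jet_def const_poly_sum[symmetric] sum_distrib_right)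
  finally show ?thesis by (simp only: mult.assoc)
qed

lemma vanish_if_jet_eq_0:
  assumes "finite I" "\<And>\<alpha>. \<alpha> \<in> exps I N \<Longrightarrow> jet I n c z \<alpha> = 0"
  shows "vanish UNIV N (eval_poly I n c) (\<lambda>i. [:z i:])"
  unfolding vanish_def
proof (intro ballI allI impI)
  fix v j assume j: "j < N"
  define p where "p = (\<Sum>\<alpha>\<in>exps I n. monom ([:jet I n c z \<alpha>:] * (\<Prod>i\<in>I. v i ^ \<alpha> i)) (sum \<alpha> I))"
  have "line (eval_poly I n c) (\<lambda>i. [:z i:]) v = p"
    by (rule line_eqI) (simp add: eval_poly_along[OF assms(1)] p_def poly_sum poly_monom)
  moreover have "coeff p j = 0"
    unfolding p_def coeff_sum coeff_monom
    using assms(2) j by (intro sum.neutral) (auto simp: exps_def)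
  ultimately show "hasse v j (eval_poly I n c) (\<lambda>i. [:z i:]) = 0" by (simp add: hasse_def)
qed

text \<open>
Vanishing to order \<open>N z\<close> at \<open>z\<close> amounts to \<open>card (exps I (N z))\<close> linear conditions over a finite
field. If there are fewer conditions than coefficients, two coefficient families share all jets, and
their difference vanishes as required.
\<close>

lemma vanishing_poly_exists:
  fixes Z :: "('i \<Rightarrow> 'a::{idom,finite}) set"
  assumes I: "finite I" and Z: "finite Z"
    and less: "(\<Sum>z\<in>Z. card (exps I (N z))) < card (exps I n)"
  obtains c where "\<exists>e\<in>exps I n. c e \<noteq> (0::'a)"
    and "\<And>z. z \<in> Z \<Longrightarrow> vanish UNIV (N z) (eval_poly I n c) (\<lambda>i. [:z i:])"
proof -
  let ?C = "PiE (exps I n) (\<lambda>_. UNIV::'a set)"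
  let ?X = "SIGMA z:Z. exps I (N z)"
  let ?T = "PiE ?X (\<lambda>_. UNIV::'a set)"
  let ?f = "\<lambda>c. \<lambda>(z, \<alpha>)\<in>?X. jet I n c z \<alpha>"
  have fX: "finite ?X" by (intro finite_SigmaI Z finite_exps[OF I])
  have q: "1 < CARD('a)"
  proof -
    have "card {0, 1::'a} \<le> CARD('a)" by (rule card_mono) auto
    then show ?thesis by simp
  qed
  have "card ?T = CARD('a) ^ (\<Sum>z\<in>Z. card (exps I (N z)))"
    unfolding card_PiE[OF fX] using Z finite_exps[OF I] by (simp add: card_SigmaI)
  moreover have "card ?C = CARD('a) ^ card (exps I n)"
    by (simp add: card_PiE[OF finite_exps[OF I]])
  ultimately have "card ?T < card ?C" using less q by simp
  moreover have "?f ` ?C \<subseteq> ?T"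
    unfolding image_subset_iff restrict_PiE_iff by blast
  moreover have "finite ?T" using fX by (intro finite_PiE) auto
  ultimately have "\<not> inj_on ?f ?C" using card_inj_on_le[of ?f ?C ?T] by linarith
  then obtain c1 c2 where c: "c1 \<in> ?C" "c2 \<in> ?C" "?f c1 = ?f c2" "c1 \<noteq> c2"
    unfolding inj_on_def by blast
  define c where "c e = c1 e - c2 e" for e
  have "\<exists>e\<in>exps I n. c e \<noteq> 0"
  proof -
    obtain e where e: "c1 e \<noteq> c2 e" using c(4) by blast
    then have "e \<in> exps I n" using PiE_arb[OF c(1), of e] PiE_arb[OF c(2), of e] by metis
    then show ?thesis using e by (auto simp: c_def)
  qed
  moreover have "vanish UNIV (N z) (eval_poly I n c) (\<lambda>i. [:z i:])" if z: "z \<in> Z" for z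
  proof (rule vanish_if_jet_eq_0[OF I])
    fix \<alpha> assume "\<alpha> \<in> exps I (N z)"
    then have "jet I n c1 z \<alpha> = jet I n c2 z \<alpha>" using fun_cong[OF c(3), of "(z, \<alpha>)"] z by simp
    then show "jet I n c z \<alpha> = 0" by (simp add: jet_def c_def algebra_simps sum_subtractf)
  qed
  ultimately show ?thesis by (rule that)
qed

lemma power_le_fact_mult_binomial: "(n + 1) ^ m \<le> fact m * ((n + m) choose m)"
proof -
  have "(n + 1) ^ m * fact n \<le> fact (n + m)" for n
  proof (induction m)
    case (Suc m)
    have "(n + 1) ^ Suc m * fact n \<le> (n + 1) * fact (n + m)"
      using mult_left_mono[OF Suc, of "n + 1"] by (simp only: power_Suc mult.assoc)
    also have "\<dots> \<le> fact (n + Suc m)" by simp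
    finally show ?case .
  qed simp
  moreover have "fact (n + m) = fact m * ((n + m) choose m) * fact n"
    using binomial_fact_lemma[of m "n + m"] by (simp add: mult_ac)
  ultimately show ?thesis by (metis fact_gt_zero mult_le_cancel2)
qed

text \<open>
The count of conditions for the orders used in \<open>graph_kakeya\<close>. Up to the common factor
\<open>(8 * m\<^sup>2) ^ m / fact m\<close>, a point of the sparse set contributes at most \<open>(1 + 9 / (8 * m)) ^ m \<le> exp (9 / 8)\<close>
and any other point at most \<open>(1 - 3 / (8 * m)) ^ m \<le> exp (- 3 / 8)\<close>. As \<open>exp (9 / 8) / 20 + exp (- 3 / 8)\<close> is less
than 1, the total stays below the number \<open>q ^ m\<close> that the coefficients contribute.
\<close>

lemma binomial_mix_less:
  fixes m q b Z :: nat
  assumes m: "m \<ge> 1" and q: "q \<ge> 1" and Z: "Z = q ^ m" and b: "20 * b \<le> Z"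
  shows "b * ((8 * m\<^sup>2 + 8 * m - 1 + m) choose m) + (Z - b) * ((8 * m\<^sup>2 - 4 * m - 1 + m) choose m)
    < (8 * m\<^sup>2 * q - 1 + m) choose m"
proof -
  have mm: "m \<le> m\<^sup>2" by (simp add: power2_eq_square)
  let ?A = "(8 * m\<^sup>2 + 8 * m - 1 + m) choose m"
  let ?B = "(8 * m\<^sup>2 - 4 * m - 1 + m) choose m"
  let ?C = "(8 * m\<^sup>2 * q - 1 + m) choose m"
  have A: "real ?A * fact m \<le> (8 * real m ^ 2 + 9 * real m) ^ m"
  proof -
    have "?A * fact m \<le> (8 * m\<^sup>2 + 8 * m - 1 + m) ^ m" by (rule binomial_fact_pow)
    also have "\<dots> \<le> (8 * m\<^sup>2 + 9 * m) ^ m" by (intro power_mono) auto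
    finally have "real (?A * fact m) \<le> real ((8 * m\<^sup>2 + 9 * m) ^ m)" by (rule of_nat_mono)
    then show ?thesis by simp
  qed
  have B: "real ?B * fact m \<le> (8 * real m ^ 2 - 3 * real m) ^ m"
  proof -
    have "?B * fact m \<le> (8 * m\<^sup>2 - 4 * m - 1 + m) ^ m" by (rule binomial_fact_pow)
    also have "\<dots> \<le> (8 * m\<^sup>2 - 3 * m) ^ m" using mm m by (intro power_mono) auto
    finally have "real (?B * fact m) \<le> real ((8 * m\<^sup>2 - 3 * m) ^ m)" by (rule of_nat_mono)
    moreover have "real (8 * m\<^sup>2 - 3 * m) = 8 * real m ^ 2 - 3 * real m" using mm by (simp add: of_nat_diff)
    ultimately show ?thesis by simp
  qed
  have C: "(8 * real m ^ 2 * real q) ^ m \<le> real ?C * fact m"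
  proof -
    have "8 * m\<^sup>2 * q - 1 + 1 = 8 * m\<^sup>2 * q" using m q by simp
    then have "(8 * m\<^sup>2 * q) ^ m \<le> fact m * ?C"
      using power_le_fact_mult_binomial[of "8 * m\<^sup>2 * q - 1" m] by simp
    then have "real ((8 * m\<^sup>2 * q) ^ m) \<le> real (fact m * ?C)" by (rule of_nat_mono)
    then show ?thesis by (simp add: mult.commute)
  qed
  have m0: "real m > 0" using m by simp
  have a: "(1 + (9/8) / real m) ^ m \<le> 4"
  proof -
    have "(1 + (9/8) / real m) ^ m \<le> exp (9/8)" using m by (intro exp_ge_one_plus_x_over_n_power_n) auto
    also have "exp (9/8::real) \<le> 4"
    proof -
      have "exp (9/8::real) ^ 8 = exp 1 ^ 9" by (simp add: exp_of_nat_mult[symmetric])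
      also have "\<dots> \<le> 3 ^ 9" by (intro power_mono exp_le) auto
      also have "\<dots> \<le> (4::real) ^ 8" by simp
      finally show ?thesis by (rule power_le_imp_le_base[of _ 7, simplified]) simp
    qed
    finally show ?thesis .
  qed
  have b': "(1 - (3/8) / real m) ^ m \<le> 8/11"
  proof -
    have "(1 + (-3/8) / real m) ^ m \<le> exp (-3/8)" using m by (intro exp_ge_one_plus_x_over_n_power_n) auto
    also have "exp (-3/8::real) = 1 / exp (3/8)" by (simp add: exp_minus inverse_eq_divide)
    also have "\<dots> \<le> 1 / (1 + 3/8)" by (intro divide_left_mono exp_ge_add_one_self) auto
    finally show ?thesis by simp
  qed
  have f1: "(8 * real m ^ 2 + 9 * real m) ^ m \<le> 4 * (8 * real m ^ 2) ^ m"
  proof -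
    have "8 * real m ^ 2 + 9 * real m = (8 * real m ^ 2) * (1 + (9/8) / real m)"
      using m0 by (simp add: field_simps power2_eq_square)
    then show ?thesis using mult_left_mono[OF a, of "(8 * real m ^ 2) ^ m"]
      by (simp add: power_mult_distrib mult.commute)
  qed
  have f2: "(8 * real m ^ 2 - 3 * real m) ^ m \<le> 8/11 * (8 * real m ^ 2) ^ m"
  proof -
    have "8 * real m ^ 2 - 3 * real m = (8 * real m ^ 2) * (1 - (3/8) / real m)"
      using m0 by (simp add: field_simps power2_eq_square)
    then show ?thesis using mult_left_mono[OF b', of "(8 * real m ^ 2) ^ m"]
      by (simp add: power_mult_distrib mult.commute)
  qed
  have Z0: "real Z > 0" using q Z by simp
  have P: "(8 * real m ^ 2) ^ m > 0" using m0 by simp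
  have "real (b * ?A + (Z - b) * ?B) * fact m = real b * (real ?A * fact m) + real (Z - b) * (real ?B * fact m)"
    by (simp only: of_nat_add of_nat_mult distrib_right mult.assoc)
  also have "\<dots> \<le> real b * (4 * (8 * real m ^ 2) ^ m) + real Z * (8/11 * (8 * real m ^ 2) ^ m)"
    by (intro add_mono mult_mono order.trans[OF A f1] order.trans[OF B f2]) auto
  also have "\<dots> \<le> (real Z / 20 * 4 + real Z * (8/11)) * (8 * real m ^ 2) ^ m"
  proof -
    have "real b \<le> real Z / 20" using b by linarith
    then show ?thesis using P mult_right_mono[of "real b" "real Z / 20" "4 * (8 * real m ^ 2) ^ m"]
      by (simp add: algebra_simps)
  qed
  also have "\<dots> < real Z * (8 * real m ^ 2) ^ m"
    using Z0 P by (intro mult_strict_right_mono) auto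
  also have "\<dots> = (8 * real m ^ 2 * real q) ^ m" by (simp add: Z power_mult_distrib)
  also have "\<dots> \<le> real ?C * fact m" by (rule C)
  finally have "real (b * ?A + (Z - b) * ?B) < real ?C"
    by (simp only: mult_less_cancel_right_pos fact_gt_zero)
  then show ?thesis by (simp only: of_nat_less_iff)
qed

section \<open>Evaluation at an algebraically generic point\<close>

lemma digits_unique:
  fixes a b :: "nat \<Rightarrow> nat"
  assumes "\<And>i. i < m \<Longrightarrow> a i < B" "\<And>i. i < m \<Longrightarrow> b i < B"
    and "(\<Sum>i<m. a i * B ^ i) = (\<Sum>i<m. b i * B ^ i)" and "i < m"
  shows "a i = b i"
  using assms
proof (induction m arbitrary: a b i)
  case (Suc m)
  have e: "a 0 + B * (\<Sum>i<m. a (Suc i) * B ^ i) = b 0 + B * (\<Sum>i<m. b (Suc i) * B ^ i)"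
    using Suc.prems(3) by (simp add: sum.lessThan_Suc_shift sum_distrib_left mult_ac del: sum.lessThan_Suc)
  have lt: "a 0 < B" "b 0 < B" using Suc.prems(1,2) by auto
  have 0: "a 0 = b 0" using arg_cong[OF e, of "\<lambda>x. x mod B"] lt by simp
  then have "(\<Sum>i<m. a (Suc i) * B ^ i) = (\<Sum>i<m. b (Suc i) * B ^ i)" using e lt by simp
  then have "a (Suc i) = b (Suc i)" if "i < m" for i
    using Suc.IH[of "\<lambda>i. a (Suc i)" "\<lambda>i. b (Suc i)" i] Suc.prems(1,2) that by auto
  then show ?case using 0 Suc.prems(4) by (cases i) auto
qed simp

text \<open>
Substituting powers of one indeterminate with exponents \<open>n ^ idx i\<close> sends distinct monomials of degree
less than \<open>n\<close> to distinct powers, by uniqueness of base \<open>n\<close> digits. Hence a nonzero polynomial of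
degree less than \<open>n\<close> does not vanish at this point.
\<close>

lemma kronecker_exponents:
  assumes "finite I"
  obtains idx where "inj_on idx I"
    "\<And>e e'. e \<in> exps I n \<Longrightarrow> e' \<in> exps I n \<Longrightarrow>
       (\<Sum>i\<in>I. e i * n ^ idx i) = (\<Sum>i\<in>I. e' i * n ^ idx i) \<Longrightarrow> e = e'"
proof -
  obtain h where h: "bij_betw h I {0..<card I}" using ex_bij_betw_finite_nat[OF assms] by blast
  have inj: "inj_on h I" using h by (rule bij_betw_imp_inj_on)
  let ?g = "inv_into I h"
  have code: "(\<Sum>i\<in>I. e i * n ^ h i) = (\<Sum>k<card I. e (?g k) * n ^ k)" for e
  proof -
    have "(\<Sum>i\<in>I. e i * n ^ h i) = (\<Sum>i\<in>I. e (?g (h i)) * n ^ h i)"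
      using inj by (intro sum.cong) auto
    also have "\<dots> = (\<Sum>k\<in>{0..<card I}. e (?g k) * n ^ k)"
      by (rule sum.reindex_bij_betw[OF h])
    finally show ?thesis by (simp add: atLeast0LessThan)
  qed
  have "e = e'" if e: "e \<in> exps I n" "e' \<in> exps I n"
      and eq: "(\<Sum>i\<in>I. e i * n ^ h i) = (\<Sum>i\<in>I. e' i * n ^ h i)" for e e'
  proof (rule PiE_ext)
    show "e \<in> PiE I (\<lambda>_. UNIV)" "e' \<in> PiE I (\<lambda>_. UNIV)" using e by (auto simp: exps_def)
    fix i assume i: "i \<in> I"
    have gI: "?g k \<in> I" if "k < card I" for k
      using that h by (auto simp: bij_betw_def intro!: inv_into_into)
    have "e (?g (h i)) = e' (?g (h i))"
    proof (rule digits_unique[of "card I" "\<lambda>k. e (?g k)" n "\<lambda>k. e' (?g k)"])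
      show "(\<Sum>k<card I. e (?g k) * n ^ k) = (\<Sum>k<card I. e' (?g k) * n ^ k)"
        using eq by (simp add: code)
      show "h i < card I" using h i by (auto simp: bij_betw_def)
    qed (use gI exps_lt[OF assms e(1)] exps_lt[OF assms e(2)] in auto)
    then show "e i = e' i" using inj i by simp
  qed
  then show ?thesis using that inj by blast
qed

section \<open>A Kakeya theorem for graphs of linear maps\<close>

text \<open>
The point \<open>(y + A t, t)\<close> on the graph of an affine map. The indices \<open>Inl j\<close> carry its value and the indices
\<open>Inr l\<close> its argument.
\<close>

definition graph_pt :: "'k set \<Rightarrow> ('j \<Rightarrow> 'a::comm_ring_1) \<Rightarrow> ('j \<Rightarrow> 'k \<Rightarrow> 'a) \<Rightarrow> ('k \<Rightarrow> 'a) \<Rightarrow> 'j + 'k \<Rightarrow> 'a" where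
  "graph_pt K y A t = (\<lambda>i. case i of Inl j \<Rightarrow> y j + (\<Sum>l\<in>K. A j l * t l) | Inr l \<Rightarrow> t l)"

lemma graph_pt_mem:
  fixes K :: "'k set" and y :: "'j::finite \<Rightarrow> 'a::comm_ring_1"
  shows "t \<in> PiE K (\<lambda>_. UNIV) \<Longrightarrow> graph_pt K y A t \<in> PiE (UNIV <+> K) (\<lambda>_. UNIV)"
  by (auto simp: graph_pt_def PiE_iff extensional_def split: sum.split)

lemma sum_mult_delta:
  fixes f :: "'k \<Rightarrow> 'r::comm_semiring_1"
  assumes "finite K"
  shows "(\<Sum>l\<in>K. f l * (if k = l then 1 else 0)) = (if k \<in> K then f k else 0)"
proof -
  have "(\<Sum>l\<in>K. f l * (if k = l then 1 else 0)) = (\<Sum>l\<in>K. if k = l then f l else 0)"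
    by (intro sum.cong) auto
  then show ?thesis using assms by simp
qed

text \<open>
A sparse set cannot contain half of a graph with linear part \<open>A\<close> for a quarter of all \<open>A\<close>. The
numbers fit as follows. Let \<open>Q = q ^ card K\<close>. On a half-covered flat the orders sum to at least
\<open>Q * (8 * m\<^sup>2 + 2 * m)\<close>. A derivative of order less than \<open>2 * m\<close> retains at least \<open>Q * (8 * m\<^sup>2)\<close>, which is more than
\<open>d * Q / q\<close> because \<open>d < 8 * m\<^sup>2 * q\<close>. So these derivatives vanish on the flat and the top form has order
\<open>2 * m\<close> at the direction \<open>w A\<close>. These directions fill a quarter of a grid of side \<open>Q\<close>, which forces
\<open>2 * m * Q / 4 \<le> d\<close>, whereas \<open>16 * m * q \<le> Q\<close> gives \<open>2 * m * Q / 4 \<ge> 8 * m\<^sup>2 * q\<close>.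
\<close>

lemma graph_kakeya:
  fixes B :: "('j::finite + 'k \<Rightarrow> 'a::{field,finite}) set" and \<A> :: "('j \<Rightarrow> 'k \<Rightarrow> 'a) set"
  assumes K: "finite K" and m: "m = CARD('j) + card K"
    and large: "16 * m * CARD('a) \<le> CARD('a) ^ card K"
    and B: "B \<subseteq> PiE (UNIV <+> K) (\<lambda>_. UNIV)" "20 * card B \<le> CARD('a) ^ m"
    and \<A>: "\<A> \<subseteq> PiE UNIV (\<lambda>_. PiE K (\<lambda>_. UNIV))"
    and half: "\<And>A. A \<in> \<A> \<Longrightarrow> \<exists>y. CARD('a) ^ card K \<le> 2 * card {t \<in> PiE K (\<lambda>_. UNIV). graph_pt K y A t \<in> B}"
  shows "4 * card \<A> < CARD('a) ^ (card K * CARD('j))"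
proof (rule ccontr)
  assume "\<not> ?thesis"
  then have many: "CARD('a) ^ (card K * CARD('j)) \<le> 4 * card \<A>" by simp
  define q where "q = CARD('a)"
  define I where "I = (UNIV::'j set) <+> K"
  define n where "n = 8 * m\<^sup>2 * q"
  define N where "N z = (if z \<in> B then 8 * m\<^sup>2 + 8 * m else 8 * m\<^sup>2 - 4 * m)" for z
  define Z where "Z = PiE I (\<lambda>_. UNIV :: 'a set)"
  have I: "finite I" using K by (simp add: I_def)
  have cI: "card I = m" using K by (simp add: I_def m card_Plus)
  have q: "q \<ge> 1" by (simp add: q_def Suc_leI)
  have m1: "m \<ge> 1" using m by (simp add: Suc_leI add_increasing2)
  have mm: "m \<le> m\<^sup>2" by (simp add: power2_eq_square)
  have fZ: "finite Z" unfolding Z_def using I by (intro finite_PiE) auto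
  have cZ: "card Z = q ^ m" unfolding Z_def by (simp add: card_PiE[OF I] cI q_def)
  have BZ: "B \<subseteq> Z" using B(1) by (simp add: Z_def I_def)
  have "(\<Sum>z\<in>Z. card (exps I (N z))) < card (exps I n)"
  proof -
    have c: "card (exps I k) = (k - 1 + m) choose m" if "k > 0" for k
      using card_exps[OF I, of "k - 1"] that by (simp add: cI)
    have N0: "N z > 0" for z using mm m1 by (auto simp: N_def)
    have n0: "n > 0" using m1 q by (simp add: n_def)
    have "(\<Sum>z\<in>Z. card (exps I (N z))) =
        (\<Sum>z\<in>B. card (exps I (N z))) + (\<Sum>z\<in>Z - B. card (exps I (N z)))"
      using sum.subset_diff[OF BZ fZ] by (simp add: add.commute)
    also have "(\<Sum>z\<in>B. card (exps I (N z))) = card B * ((8 * m\<^sup>2 + 8 * m - 1 + m) choose m)"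
      by (simp add: c N0) (simp add: N_def)
    also have "(\<Sum>z\<in>Z - B. card (exps I (N z))) = (q ^ m - card B) * ((8 * m\<^sup>2 - 4 * m - 1 + m) choose m)"
    proof -
      have "(\<Sum>z\<in>Z - B. card (exps I (N z))) = (\<Sum>z\<in>Z - B. (8 * m\<^sup>2 - 4 * m - 1 + m) choose m)"
      proof (intro sum.cong refl)
        fix z assume "z \<in> Z - B"
        then have "N z = 8 * m\<^sup>2 - 4 * m" by (simp add: N_def)
        then show "card (exps I (N z)) = (8 * m\<^sup>2 - 4 * m - 1 + m) choose m"
          using c[OF N0[of z]] by simp
      qed
      then show ?thesis using finite_subset[OF BZ fZ] by (simp add: card_Diff_subset BZ cZ)
    qed
    also have "card B * ((8 * m\<^sup>2 + 8 * m - 1 + m) choose m) + \<dots> < (8 * m\<^sup>2 * q - 1 + m) choose m"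
      using B(2) by (intro binomial_mix_less m1 q) (auto simp: q_def)
    also have "\<dots> = card (exps I n)" using c[OF n0] by (simp add: n_def)
    finally show ?thesis .
  qed
  from vanishing_poly_exists[OF I fZ this] obtain c
    where c: "\<exists>e\<in>exps I n. c e \<noteq> (0::'a)"
      and van: "\<And>z. z \<in> Z \<Longrightarrow> vanish UNIV (N z) (eval_poly I n c) (\<lambda>i. [:z i:])" by metis
  define F where "F = eval_poly I n c"
  define E where "E = {e \<in> exps I n. c e \<noteq> 0}"
  have E: "finite E" "E \<noteq> {}" using finite_exps[OF I] c by (auto simp: E_def)
  define d where "d = Max ((\<lambda>e. sum e I) ` E)"
  have "d \<in> (\<lambda>e. sum e I) ` E" unfolding d_def using E by (intro Max_in) auto
  then obtain e0 where e0: "e0 \<in> exps I n" "c e0 \<noteq> 0" "sum e0 I = d" by (auto simp: E_def)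
  have dn: "d < n" using e0 by (auto simp: exps_def)
  have polyF: "poly_fun d F"
    unfolding F_def using E(1)
    by (intro poly_fun_eval_poly) (auto simp: d_def E_def intro!: Max_ge)
  obtain H where polyH: "poly_fun d H" and H: "\<And>x v. hasse v d F x = H v"
    using top_form[OF polyF] by blast
  obtain idx where idx: "inj_on idx I"
    "\<And>e e'. e \<in> exps I n \<Longrightarrow> e' \<in> exps I n \<Longrightarrow>
       (\<Sum>i\<in>I. e i * n ^ idx i) = (\<Sum>i\<in>I. e' i * n ^ idx i) \<Longrightarrow> e = e'"
    using kronecker_exponents[OF I] by blast
  \<comment> \<open>a point at which the top form cannot vanish; its last coordinates \<open>\<theta>\<close> also span the flats generically\<close>
  define \<kappa> :: "'j + 'k \<Rightarrow> 'a poly" where "\<kappa> i = (if i \<in> I then monom 1 (n ^ idx i) else 0)" for i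
  have "H \<kappa> \<noteq> 0"
  proof -
    let ?code = "\<lambda>e. \<Sum>i\<in>I. e i * n ^ idx i"
    have mon: "(\<Prod>i\<in>I. \<kappa> i ^ e i) = monom 1 (?code e)" for e
    proof -
      have "(\<Prod>i\<in>I. \<kappa> i ^ e i) = (\<Prod>i\<in>I. monom 1 (e i * n ^ idx i))"
        by (intro prod.cong) (auto simp: \<kappa>_def monom_power mult.commute)
      also have "\<dots> = monom 1 (?code e)"
        using I by (induction I rule: finite_induct) (auto simp: mult_monom one_pCons monom_0)
      finally show ?thesis .
    qed
    have "line F (\<lambda>_. 0) \<kappa> = (\<Sum>e\<in>exps I n. monom ([:c e:] * monom 1 (?code e)) (sum e I))"
      by (rule line_eqI)
        (simp add: F_def eval_poly_def poly_sum poly_monom power_mult_distrib prod.distrib mon power_sum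
          mult_ac)
    then have "H \<kappa> = (\<Sum>e\<in>exps I n. if sum e I = d then [:c e:] * monom 1 (?code e) else 0)"
      using H[of \<kappa> "\<lambda>_. 0"] by (simp add: hasse_def coeff_sum cong: if_cong)
    then have "coeff (H \<kappa>) (?code e0) =
        (\<Sum>e\<in>exps I n. coeff (if sum e I = d then [:c e:] * monom 1 (?code e) else 0) (?code e0))"
      by (simp only: coeff_sum)
    also have "\<dots> = (\<Sum>e\<in>exps I n. if e = e0 then c e0 else 0)"
    proof (intro sum.cong refl)
      fix e assume e: "e \<in> exps I n"
      have "?code e = ?code e0 \<longleftrightarrow> e = e0" using idx(2)[OF e e0(1)] by blast
      then show "coeff (if sum e I = d then [:c e:] * monom 1 (?code e) else 0) (?code e0) =
          (if e = e0 then c e0 else 0)"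
        using e0(3) by auto
    qed
    also have "\<dots> = c e0" using e0 finite_exps[OF I] by simp
    finally show ?thesis using e0(2) by auto
  qed
  define \<theta> where "\<theta> l = \<kappa> (Inr l)" for l
  define w where "w A = (\<lambda>i. case i of Inl j \<Rightarrow> (\<Sum>l\<in>K. \<theta> l * [:A j l:]) | Inr l \<Rightarrow> \<theta> l)"
    for A :: "'j \<Rightarrow> 'k \<Rightarrow> 'a"
  have vanH: "vanish UNIV (2 * m) H (w A)" if A: "A \<in> \<A>" for A
    unfolding vanish_def
  proof (intro ballI allI impI)
    fix v :: "'j + 'k \<Rightarrow> 'a poly" and j assume j: "j < 2 * m"
    obtain y where y: "q ^ card K \<le> 2 * card {t \<in> PiE K (\<lambda>_. UNIV). graph_pt K y A t \<in> B}"
      using half[OF A] by (auto simp: q_def)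
    \<comment> \<open>Outside \<open>K\<close>, extensional points have the value \<open>undefined\<close>, which the base point must share.\<close>
    define x where "x = (\<lambda>i. case i of Inl j \<Rightarrow> [:y j:] | Inr l \<Rightarrow> if l \<in> K then 0 else [:undefined:])"
    define u where "u l = (\<lambda>i. case i of Inl j \<Rightarrow> [:A j l:] | Inr l' \<Rightarrow> if l' = l then 1 else 0)" for l
    define G where "G = (\<lambda>x. hasse v j F x)"
    have polyG: "poly_fun (d - j) G" unfolding G_def by (rule poly_fun_hasse[OF polyF])
    have wu: "comb K u \<theta> = w A"
    proof
      fix i show "comb K u \<theta> i = w A i"
        by (cases i) (auto simp: comb_def u_def w_def sum_mult_delta[OF K] \<theta>_def \<kappa>_def I_def)
    qed
    have pt: "flat_pt x K u (\<lambda>l. [:t l:]) = (\<lambda>i. [:graph_pt K y A t i:])" if "t \<in> PiE K (\<lambda>_. UNIV)" for t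
    proof
      fix i show "flat_pt x K u (\<lambda>l. [:t l:]) i = [:graph_pt K y A t i:]"
      proof (cases i)
        case (Inl j)
        then show ?thesis
          by (simp add: flat_pt_def comb_def x_def u_def graph_pt_def const_poly_sum mult.commute)
      next
        case (Inr l)
        then show ?thesis using that sum_mult_delta[OF K, of "\<lambda>l. [:t l:]" l]
          by (auto simp: flat_pt_def comb_def x_def u_def graph_pt_def
              PiE_def extensional_def)
      qed
    qed
    have zero: "G (flat_pt x K u s) = 0" for s
    proof (rule ccontr)
      assume nz: "G (flat_pt x K u s) \<noteq> 0"
      let ?T = "PiE K (\<lambda>_. UNIV :: 'a set)"
      let ?TB = "{t \<in> ?T. graph_pt K y A t \<in> B}"
      have fT: "finite ?T" using K by (intro finite_PiE) auto
      have cT: "card ?T = q ^ card K" by (simp add: card_PiE[OF K] q_def)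
      have "card (UNIV :: 'a set) * (\<Sum>t\<in>?T. N (graph_pt K y A t) - j) \<le> (d - j) * card (UNIV :: 'a set) ^ card K"
      proof (rule schwartz_zippel_multiplicity[OF K _ _ polyG nz])
        show "inj (\<lambda>a::'a. [:a:])" by (auto intro: injI)
        fix t :: "'k \<Rightarrow> 'a" assume t: "t \<in> ?T"
        have "vanish UNIV (N (graph_pt K y A t) - j) G (\<lambda>i. [:graph_pt K y A t i:])"
          unfolding G_def using van[of "graph_pt K y A t"] graph_pt_mem[OF t, of y A]
          by (intro vanish_hasse[OF polyF]) (auto simp: F_def Z_def I_def)
        then show "vanish (range (comb K u)) (N (graph_pt K y A t) - j) G (flat_pt x K u (\<lambda>l. [:t l:]))"
          unfolding pt[OF t] by (rule vanish_mono) simp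
      qed simp
      then have up: "q * (\<Sum>t\<in>?T. N (graph_pt K y A t) - j) \<le> d * q ^ card K"
        unfolding q_def[symmetric] by (rule order.trans) simp
      have "8 * m\<^sup>2 * q ^ card K \<le> q ^ card K * (8 * m\<^sup>2 - 6 * m) + 12 * m * card ?TB"
      proof -
        have "q ^ card K * (6 * m) \<le> 12 * m * card ?TB" using mult_left_mono[OF y, of "6 * m"] by simp
        moreover have "8 * m\<^sup>2 * q ^ card K = q ^ card K * (8 * m\<^sup>2 - 6 * m) + q ^ card K * (6 * m)"
          using mm by (simp add: distrib_left[symmetric])
        ultimately show ?thesis by simp
      qed
      also have "\<dots> = (\<Sum>t\<in>?T. (8 * m\<^sup>2 - 6 * m) + (if t \<in> ?TB then 12 * m else 0))"
        using fT by (simp add: sum.distrib cT sum.If_cases Int_def conj_commute cong: conj_cong)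
      also have "\<dots> \<le> (\<Sum>t\<in>?T. N (graph_pt K y A t) - j)"
        using j mm by (intro sum_mono) (auto simp: N_def)
      finally have "q * (8 * m\<^sup>2 * q ^ card K) \<le> d * q ^ card K"
        using up by (meson mult_le_mono2 order.trans)
      then have "n * q ^ card K \<le> d * q ^ card K" by (simp add: n_def mult_ac)
      then show False using dn q by simp
    qed
    have lineG: "hasse (w A) i G x = 0" for i
    proof -
      have "G (along x (w A) T) = 0" for T
      proof -
        have base: "flat_pt x K u (\<lambda>_. 0) = x" by (simp add: flat_pt_def comb_def)
        have "along x (w A) T = flat_pt x K u (\<lambda>l. 0 + T * \<theta> l)"
          using along_flat[where x = x and K = K and v = u and a = "\<lambda>_. 0" and b = \<theta> and s = T]
          unfolding base wu .
        then show ?thesis by (simp only: zero)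
      qed
      then have "line G x (w A) = 0" by (intro line_eqI) simp
      then show ?thesis by (simp add: hasse_def)
    qed
    \<comment> \<open>derivatives of the top form are leading coefficients of derivatives of \<open>F\<close> along \<open>w A\<close>\<close>
    have "line H (w A) v = (\<Sum>i\<le>d. monom (hasse (w A) (d - i) (\<lambda>x. hasse v i F x) x) i)"
      by (rule line_eqI) (simp add: H[of _ x, symmetric] hasse_plane[OF polyF] poly_sum poly_monom)
    then have "hasse v j H (w A) = (\<Sum>i\<le>d. if i = j then hasse (w A) (d - i) (\<lambda>x. hasse v i F x) x else 0)"
      by (simp add: hasse_def[of v j H] coeff_sum)
    also have "\<dots> = 0" using lineG by (intro sum.neutral) (auto simp: G_def)
    finally show "hasse v j H (w A) = 0" .
  qed
  define row where "row a = (\<Sum>l\<in>K. \<theta> l * [:a l:])" for a :: "'k \<Rightarrow> 'a"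
  define x0 :: "'j + 'k \<Rightarrow> 'a poly" where "x0 = (\<lambda>i. case i of Inl j \<Rightarrow> 0 | Inr l \<Rightarrow> \<theta> l)"
  define unit :: "'j \<Rightarrow> 'j + 'k \<Rightarrow> 'a poly" where "unit j = (\<lambda>i. if i = Inl j then 1 else 0)" for j
  let ?R = "PiE K (\<lambda>_. UNIV :: 'a set)"
  let ?M = "PiE (UNIV :: 'j set) (\<lambda>_. ?R)"
  have comb_unit: "comb UNIV unit s (Inl j) = s j" "comb UNIV unit s (Inr l) = 0" for s j l
    using sum_mult_delta[of UNIV s j] by (auto simp: comb_def unit_def)
  have cR: "card ?R = q ^ card K" by (simp add: card_PiE[OF K] q_def)
  have fR: "finite ?R" using K by (intro finite_PiE) auto
  have inj_row: "inj_on row ?R"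
  proof (rule inj_onI)
    fix a b assume a: "a \<in> ?R" and b: "b \<in> ?R" and eq: "row a = row b"
    have n2: "n \<ge> 2"
    proof -
      have "1 * 1 \<le> m\<^sup>2 * q" using m1 q by (intro mult_mono) auto
      then show ?thesis by (simp add: n_def)
    qed
    have co: "coeff (row a) (n ^ idx (Inr l)) = a l" if l: "l \<in> K" for a l
    proof -
      have "coeff (row a) (n ^ idx (Inr l)) = (\<Sum>l'\<in>K. if l' = l then a l else 0)"
        unfolding row_def coeff_sum
      proof (intro sum.cong refl)
        fix l' assume l': "l' \<in> K"
        have "n ^ idx (Inr l') = n ^ idx (Inr l) \<longleftrightarrow> l' = l"
          using n2 inj_onD[OF idx(1), of "Inr l'" "Inr l"] l l' by (auto simp: I_def)
        then show "coeff (\<theta> l' * [:a l':]) (n ^ idx (Inr l)) = (if l' = l then a l else 0)"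
          using l' by (auto simp: \<theta>_def \<kappa>_def I_def)
      qed
      then show ?thesis using K l by simp
    qed
    show "a = b" by (rule PiE_ext[OF a b]) (metis co eq)
  qed
  have "card ?R * (\<Sum>A\<in>?M. if A \<in> \<A> then 2 * m else 0) \<le> d * card ?R ^ card (UNIV :: 'j set)"
  proof (rule schwartz_zippel_multiplicity[OF _ fR inj_row polyH])
    have "flat_pt x0 UNIV unit (\<lambda>j. \<kappa> (Inl j)) = \<kappa>"
    proof
      fix i show "flat_pt x0 UNIV unit (\<lambda>j. \<kappa> (Inl j)) i = \<kappa> i"
        by (cases i) (auto simp: flat_pt_def comb_unit x0_def \<theta>_def)
    qed
    then show "H (flat_pt x0 UNIV unit (\<lambda>j. \<kappa> (Inl j))) \<noteq> 0" using \<open>H \<kappa> \<noteq> 0\<close> by simp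
    fix A :: "'j \<Rightarrow> 'k \<Rightarrow> 'a"
    have "flat_pt x0 UNIV unit (\<lambda>j. row (A j)) = w A"
    proof
      fix i show "flat_pt x0 UNIV unit (\<lambda>j. row (A j)) i = w A i"
        by (cases i) (auto simp: flat_pt_def comb_unit x0_def w_def row_def)
    qed
    then show "vanish (range (comb UNIV unit)) (if A \<in> \<A> then 2 * m else 0) H
        (flat_pt x0 UNIV unit (\<lambda>j. row (A j)))"
      using vanish_mono[OF vanH[of A] subset_UNIV] by (auto simp: vanish_def)
  qed simp
  moreover have "(\<Sum>A\<in>?M. if A \<in> \<A> then 2 * m else 0) = 2 * m * card \<A>"
  proof -
    have "finite ?M" by (rule finite_PiE) (simp, rule fR)
    then have "(\<Sum>A\<in>?M. if A \<in> \<A> then 2 * m else 0) = (\<Sum>A\<in>?M \<inter> \<A>. 2 * m)"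
      by (rule sum.inter_restrict[symmetric])
    also have "?M \<inter> \<A> = \<A>" using \<A> by auto
    finally show ?thesis by simp
  qed
  ultimately have le: "q ^ card K * (2 * m * card \<A>) \<le> d * q ^ (card K * CARD('j))"
    by (simp add: cR power_mult)
  have "16 * m * q * (2 * m) * q ^ (card K * CARD('j)) \<le> q ^ card K * (2 * m) * (4 * card \<A>)"
    using large many unfolding q_def[symmetric] by (intro mult_mono) auto
  also have "\<dots> \<le> 4 * d * q ^ (card K * CARD('j))" using le by (simp add: mult_ac)
  finally have "4 * n * q ^ (card K * CARD('j)) \<le> 4 * d * q ^ (card K * CARD('j))"
    by (simp add: n_def power2_eq_square mult_ac)
  then show False using dn q by simp
qed

section \<open>Second moments of random linear maps\<close>

definition ip :: "'a::comm_ring_1 ^ 'n \<Rightarrow> 'a ^ 'n \<Rightarrow> 'a" where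
  "ip g x = (\<Sum>i\<in>UNIV. g $ i * x $ i)"

lemma ip_add: "ip (g + h) x = ip g x + ip h x"
  by (simp add: ip_def algebra_simps sum.distrib)

lemma ip_scale: "ip (c *s g) x = c * ip g x"
  by (simp add: ip_def sum_distrib_left mult.assoc)

lemma ip_diff: "ip (g - h) x = ip g x - ip h x"
  by (simp add: ip_def algebra_simps sum_subtractf)

lemma ip_sum: "ip (\<Sum>l\<in>K. g l) x = (\<Sum>l\<in>K. ip (g l) x)"
proof -
  have "ip 0 x = 0" by (simp add: ip_def)
  then show ?thesis by (induction K rule: infinite_finite_induct) (auto simp: ip_add)
qed

lemma ip_diff_right: "ip g (x - y) = ip g x - ip g y"
  by (simp add: ip_def algebra_simps sum_subtractf)

lemma card_hyperplane:
  fixes d :: "'a::{field,finite} ^ 'n"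
  assumes "d \<noteq> 0"
  shows "card {g. ip g d = 0} * CARD('a) = CARD('a ^ 'n)"
proof -
  obtain k where k: "d $ k \<noteq> 0" using assms by (auto simp: vec_eq_iff)
  let ?e = "axis k (1 / d $ k)"
  have e: "ip ?e d = 1"
    using k by (simp add: ip_def axis_def if_distrib[of "\<lambda>z. z * _"] cong: if_cong)
  have "bij_betw (\<lambda>(g, a). g + a *s ?e) ({g. ip g d = 0} \<times> UNIV) UNIV"
    by (rule bij_betwI[where g = "\<lambda>h. (h - ip h d *s ?e, ip h d)"])
      (auto simp: ip_add ip_diff ip_scale e)
  from bij_betw_same_card[OF this] show ?thesis by (simp add: card_cartesian_product)
qed

definition hash :: "'i set \<Rightarrow> ('i \<Rightarrow> 'a::comm_ring_1 ^ 'n) \<Rightarrow> 'a ^ 'n \<Rightarrow> 'i \<Rightarrow> 'a" where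
  "hash I \<omega> x = (\<lambda>i\<in>I. ip (\<omega> i) x)"

lemma card_collisions:
  fixes x y :: "'a::{field,finite} ^ 'n" and I :: "'i set"
  assumes "finite I" "x \<noteq> y"
  shows "card {\<omega> \<in> PiE I (\<lambda>_. UNIV). hash I \<omega> x = hash I \<omega> y} * CARD('a) ^ card I
    = card (PiE I (\<lambda>_. UNIV :: ('a ^ 'n) set))"
proof -
  have "hash I \<omega> x = hash I \<omega> y \<longleftrightarrow> (\<forall>i\<in>I. ip (\<omega> i) (x - y) = 0)" for \<omega> :: "'i \<Rightarrow> 'a ^ 'n"
    by (auto simp: hash_def ip_diff_right fun_eq_iff restrict_def)
  then have "{\<omega> \<in> PiE I (\<lambda>_. UNIV). hash I \<omega> x = hash I \<omega> y} = PiE I (\<lambda>_. {g. ip g (x - y) = 0})"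
    by (auto simp: PiE_iff extensional_def)
  then show ?thesis
    using card_hyperplane[of "x - y"] assms
    by (simp add: card_PiE power_mult_distrib[symmetric])
qed

text \<open>
The variance of the fibre sizes counts pairs in \<open>T\<close> with equal images. Distinct points collide with
probability \<open>1 / q ^ card I\<close>, which cancels the square of the mean and leaves the diagonal pairs.
\<close>

lemma hash_second_moment:
  fixes T :: "('a::{field,finite} ^ 'n) set"
  assumes I: "finite I"
  defines "\<Omega> \<equiv> PiE I (\<lambda>_. UNIV :: ('a ^ 'n) set)" and "Z \<equiv> PiE I (\<lambda>_. UNIV :: 'a set)"
    and "\<nu> \<equiv> real (card T) / real CARD('a) ^ card I"
  shows "(\<Sum>\<omega>\<in>\<Omega>. \<Sum>z\<in>Z. (real (card {x \<in> T. hash I \<omega> x = z}) - \<nu>)\<^sup>2) \<le> real (card \<Omega>) * real (card T)"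
proof -
  let ?Q = "real CARD('a) ^ card I"
  let ?c = "\<lambda>\<omega> z. real (card {x \<in> T. hash I \<omega> x = z})"
  let ?h = "\<lambda>\<omega> x y. if hash I \<omega> x = hash I \<omega> y then 1 else 0 :: real"
  have fZ: "finite Z" unfolding Z_def using I by (intro finite_PiE) auto
  have f\<Omega>: "finite \<Omega>" unfolding \<Omega>_def using I by (intro finite_PiE) auto
  have cZ: "real (card Z) = ?Q" by (simp add: Z_def card_PiE[OF I])
  have Q: "?Q > 0" by simp
  have hZ: "hash I \<omega> x \<in> Z" for \<omega> and x :: "'a ^ 'n" by (auto simp: hash_def Z_def)
  have c: "?c \<omega> z = (\<Sum>x\<in>T. if hash I \<omega> x = z then 1 else 0)" for \<omega> z
    by (simp add: sum.If_cases Int_def)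
  have s1: "(\<Sum>z\<in>Z. ?c \<omega> z) = real (card T)" for \<omega>
    unfolding c by (subst sum.swap) (simp add: fZ hZ)
  have s2: "(\<Sum>z\<in>Z. (?c \<omega> z)\<^sup>2) = (\<Sum>x\<in>T. \<Sum>y\<in>T. ?h \<omega> x y)" for \<omega>
  proof -
    have "(\<Sum>z\<in>Z. (?c \<omega> z)\<^sup>2) = (\<Sum>z\<in>Z. \<Sum>x\<in>T. \<Sum>y\<in>T. if hash I \<omega> x = z then ?h \<omega> x y else 0)"
      unfolding c power2_eq_square sum_product by (intro sum.cong refl) auto
    also have "\<dots> = (\<Sum>x\<in>T. \<Sum>y\<in>T. \<Sum>z\<in>Z. if hash I \<omega> x = z then ?h \<omega> x y else 0)"
      by (subst sum.swap, intro sum.cong refl, rule sum.swap)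
    also have "\<dots> = (\<Sum>x\<in>T. \<Sum>y\<in>T. ?h \<omega> x y)" by (simp add: fZ hZ)
    finally show ?thesis .
  qed
  have var: "(\<Sum>z\<in>Z. (?c \<omega> z - \<nu>)\<^sup>2) = (\<Sum>x\<in>T. \<Sum>y\<in>T. ?h \<omega> x y) - \<nu> * real (card T)" for \<omega>
  proof -
    have "(\<Sum>z\<in>Z. (?c \<omega> z - \<nu>)\<^sup>2) = (\<Sum>z\<in>Z. (?c \<omega> z)\<^sup>2 - 2 * \<nu> * ?c \<omega> z + \<nu>\<^sup>2)"
      by (intro sum.cong refl) (simp add: power2_diff)
    also have "\<dots> = (\<Sum>z\<in>Z. (?c \<omega> z)\<^sup>2) - 2 * \<nu> * (\<Sum>z\<in>Z. ?c \<omega> z) + real (card Z) * \<nu>\<^sup>2"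
      by (simp only: sum.distrib sum_subtractf sum_distrib_left sum_constant)
    also have "\<dots> = (\<Sum>x\<in>T. \<Sum>y\<in>T. ?h \<omega> x y) - \<nu> * real (card T)"
      unfolding s1 s2 cZ by (simp add: \<nu>_def power2_eq_square)
    finally show ?thesis .
  qed
  have col: "(\<Sum>\<omega>\<in>\<Omega>. ?h \<omega> x y) = real (card \<Omega>) / ?Q" if "x \<noteq> y" for x y
  proof -
    have "(\<Sum>\<omega>\<in>\<Omega>. ?h \<omega> x y) = real (card {\<omega> \<in> \<Omega>. hash I \<omega> x = hash I \<omega> y})"
      unfolding sum.inter_filter[OF f\<Omega>, symmetric] by simp
    moreover have "real (card {\<omega> \<in> \<Omega>. hash I \<omega> x = hash I \<omega> y}) * ?Q = real (card \<Omega>)"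
      using arg_cong[OF card_collisions[OF I that], of real] unfolding \<Omega>_def
      by (simp only: of_nat_mult of_nat_power)
    ultimately show ?thesis using Q by (simp add: field_simps)
  qed
  have "(\<Sum>\<omega>\<in>\<Omega>. \<Sum>x\<in>T. \<Sum>y\<in>T. ?h \<omega> x y) = (\<Sum>x\<in>T. \<Sum>y\<in>T. \<Sum>\<omega>\<in>\<Omega>. ?h \<omega> x y)"
    by (subst sum.swap, intro sum.cong refl, rule sum.swap)
  also have "\<dots> \<le> (\<Sum>x\<in>T. \<Sum>y\<in>T. real (card \<Omega>) / ?Q + (if x = y then real (card \<Omega>) else 0))"
  proof (intro sum_mono)
    fix x y :: "'a ^ 'n"
    show "(\<Sum>\<omega>\<in>\<Omega>. ?h \<omega> x y) \<le> real (card \<Omega>) / ?Q + (if x = y then real (card \<Omega>) else 0)"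
      using col[of x y] by (cases "x = y") auto
  qed
  also have "\<dots> = real (card \<Omega>) * \<nu> * real (card T) + real (card \<Omega>) * real (card T)"
    by (simp add: sum.distrib \<nu>_def distrib_left mult_ac)
  finally have "(\<Sum>\<omega>\<in>\<Omega>. \<Sum>x\<in>T. \<Sum>y\<in>T. ?h \<omega> x y) - real (card \<Omega>) * (\<nu> * real (card T)) \<le> real (card \<Omega>) * real (card T)"
    by simp
  then show ?thesis by (simp add: var sum_subtractf)
qed

lemma hash_chebyshev:
  fixes T :: "('a::{field,finite} ^ 'n) set"
  assumes I: "finite I" and s: "s > 0"
  defines "\<Omega> \<equiv> PiE I (\<lambda>_. UNIV :: ('a ^ 'n) set)" and "Z \<equiv> PiE I (\<lambda>_. UNIV :: 'a set)"
    and "\<nu> \<equiv> real (card T) / real CARD('a) ^ card I"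
  shows "(\<Sum>\<omega>\<in>\<Omega>. real (card {z \<in> Z. s \<le> \<bar>real (card {x \<in> T. hash I \<omega> x = z}) - \<nu>\<bar>})) * s\<^sup>2
    \<le> real (card \<Omega>) * real (card T)"
proof -
  let ?c = "\<lambda>\<omega> z. real (card {x \<in> T. hash I \<omega> x = z})"
  have fZ: "finite Z" unfolding Z_def using I by (intro finite_PiE) auto
  have "real (card {z \<in> Z. s \<le> \<bar>?c \<omega> z - \<nu>\<bar>}) * s\<^sup>2 \<le> (\<Sum>z\<in>Z. (?c \<omega> z - \<nu>)\<^sup>2)" for \<omega>
  proof -
    have "real (card {z \<in> Z. s \<le> \<bar>?c \<omega> z - \<nu>\<bar>}) * s\<^sup>2 = (\<Sum>z\<in>{z \<in> Z. s \<le> \<bar>?c \<omega> z - \<nu>\<bar>}. s\<^sup>2)" by simp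
    also have "\<dots> \<le> (\<Sum>z\<in>{z \<in> Z. s \<le> \<bar>?c \<omega> z - \<nu>\<bar>}. (?c \<omega> z - \<nu>)\<^sup>2)"
      using s by (intro sum_mono) (auto simp: abs_le_square_iff[symmetric])
    also have "\<dots> \<le> (\<Sum>z\<in>Z. (?c \<omega> z - \<nu>)\<^sup>2)" using fZ by (intro sum_mono2) auto
    finally show ?thesis .
  qed
  then have "(\<Sum>\<omega>\<in>\<Omega>. real (card {z \<in> Z. s \<le> \<bar>?c \<omega> z - \<nu>\<bar>}) * s\<^sup>2) \<le> (\<Sum>\<omega>\<in>\<Omega>. \<Sum>z\<in>Z. (?c \<omega> z - \<nu>)\<^sup>2)"
    by (intro sum_mono)
  also have "\<dots> \<le> real (card \<Omega>) * real (card T)"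
    using hash_second_moment[OF I, of T] unfolding \<Omega>_def Z_def \<nu>_def .
  finally show ?thesis by (simp add: sum_distrib_right)
qed

text \<open>
A given set \<open>T\<close> is cut by most random linear maps into pieces of which at least half have nearly the
mean size. When \<open>T\<close> is a fibre that is too large or too small, at least half of the pieces
inherit about half of its relative error.
\<close>

lemma most_hashes_spread:
  fixes T :: "('a::{field,finite} ^ 'n) set"
  assumes K: "finite K" and s: "s > 0" "9 * real (card T) \<le> s\<^sup>2 * real CARD('a) ^ card K"
  defines "\<Lambda> \<equiv> PiE K (\<lambda>_. UNIV :: ('a ^ 'n) set)" and "Z \<equiv> PiE K (\<lambda>_. UNIV :: 'a set)"
    and "\<nu> \<equiv> real (card T) / real CARD('a) ^ card K"
  shows "7 / 9 * real (card \<Lambda>) \<le>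
    real (card {l \<in> \<Lambda>. CARD('a) ^ card K \<le> 2 * card {t \<in> Z. \<bar>real (card {x \<in> T. hash K l x = t}) - \<nu>\<bar> < s}})"
proof -
  let ?dev = "\<lambda>l t. \<bar>real (card {x \<in> T. hash K l x = t}) - \<nu>\<bar>"
  let ?q = "real CARD('a) ^ card K"
  define far where "far l = card {t \<in> Z. s \<le> ?dev l t}" for l
  define near where "near l = card {t \<in> Z. ?dev l t < s}" for l
  have fZ: "finite Z" unfolding Z_def using K by (intro finite_PiE) auto
  have f\<Lambda>: "finite \<Lambda>" unfolding \<Lambda>_def using K by (intro finite_PiE) auto
  have cZ: "card Z = CARD('a) ^ card K" by (simp add: Z_def card_PiE[OF K])
  have split: "far l + near l = CARD('a) ^ card K" for l
  proof -
    have "card ({t \<in> Z. s \<le> ?dev l t} \<union> {t \<in> Z. ?dev l t < s}) = far l + near l"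
      unfolding far_def near_def using fZ by (intro card_Un_disjoint) auto
    moreover have "{t \<in> Z. s \<le> ?dev l t} \<union> {t \<in> Z. ?dev l t < s} = Z" by auto
    ultimately show ?thesis by (simp add: cZ)
  qed
  let ?X = "{l \<in> \<Lambda>. \<not> CARD('a) ^ card K \<le> 2 * near l}"
  have "real (card ?X) * (?q / 2) * s\<^sup>2 = (\<Sum>l\<in>?X. ?q / 2) * s\<^sup>2" by simp
  also have "\<dots> \<le> (\<Sum>l\<in>\<Lambda>. real (far l)) * s\<^sup>2"
  proof (intro mult_right_mono)
    have "(\<Sum>l\<in>?X. ?q / 2) \<le> (\<Sum>l\<in>?X. real (far l))"
    proof (rule sum_mono)
      fix l assume "l \<in> ?X"
      then have "2 * near l < CARD('a) ^ card K" by simp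
      then have "real (2 * near l) < real (CARD('a) ^ card K)" by (simp only: of_nat_less_iff)
      moreover have "real (far l) + real (near l) = ?q" using split[of l] by (metis of_nat_add of_nat_power)
      ultimately show "?q / 2 \<le> real (far l)" by simp
    qed
    also have "\<dots> \<le> (\<Sum>l\<in>\<Lambda>. real (far l))" using f\<Lambda> by (intro sum_mono2) auto
    finally show "(\<Sum>l\<in>?X. ?q / 2) \<le> (\<Sum>l\<in>\<Lambda>. real (far l))" .
  qed simp
  also have "\<dots> \<le> real (card \<Lambda>) * real (card T)"
    using hash_chebyshev[OF K s(1), of T] unfolding far_def \<Lambda>_def Z_def \<nu>_def .
  also have "\<dots> \<le> real (card \<Lambda>) * (s\<^sup>2 * ?q / 9)"
    using s(2) by (intro mult_left_mono) auto
  finally have "real (card ?X) * (s\<^sup>2 * ?q) \<le> 2 / 9 * real (card \<Lambda>) * (s\<^sup>2 * ?q)" by (simp add: field_simps)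
  moreover have "s\<^sup>2 * ?q > 0" using s(1) by simp
  ultimately have X: "real (card ?X) \<le> 2 / 9 * real (card \<Lambda>)" by (rule mult_right_le_imp_le)
  have "card ({l \<in> \<Lambda>. CARD('a) ^ card K \<le> 2 * near l} \<union> ?X) =
      card {l \<in> \<Lambda>. CARD('a) ^ card K \<le> 2 * near l} + card ?X"
    using f\<Lambda> by (intro card_Un_disjoint) auto
  moreover have "{l \<in> \<Lambda>. CARD('a) ^ card K \<le> 2 * near l} \<union> ?X = \<Lambda>" by auto
  ultimately have "real (card \<Lambda>) = real (card {l \<in> \<Lambda>. CARD('a) ^ card K \<le> 2 * near l}) + real (card ?X)"
    by simp
  then show ?thesis using X unfolding near_def by linarith
qed

section \<open>From unbalanced maps to graphs\<close>

text \<open>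
If every element of \<open>U\<close> lies in \<open>C \<omega>\<close> for at least the proportion \<open>\<alpha>\<close> of all \<open>\<omega>\<close>, and the mean weight is small
compared with \<open>\<alpha>\<close>, then some family covers a quarter of \<open>U\<close> at a total weight proportional to what it
covers. As long as three quarters of \<open>U\<close> are uncovered, averaging over \<open>\<omega>\<close> yields one
whose newly covered part outweighs its cost, so a family of maximal coverage qualifies. This turns an event of small probability
\<open>\<delta>\<close> into one of constant proportion, which is what makes the final bound linear in \<open>\<delta>\<close>.
\<close>

lemma greedy_cover:
  fixes w :: "'w \<Rightarrow> real" and C :: "'w \<Rightarrow> 'u set"
  assumes fin: "finite \<Omega>" "finite U" "\<Omega> \<noteq> {}" "U \<noteq> {}"
    and C: "\<And>\<omega>. \<omega> \<in> \<Omega> \<Longrightarrow> C \<omega> \<subseteq> U" and w: "\<And>\<omega>. \<omega> \<in> \<Omega> \<Longrightarrow> 0 \<le> w \<omega>"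
    and often: "\<And>A. A \<in> U \<Longrightarrow> \<alpha> * real (card \<Omega>) \<le> real (card {\<omega> \<in> \<Omega>. A \<in> C \<omega>})"
    and cheap: "(\<Sum>\<omega>\<in>\<Omega>. w \<omega>) \<le> \<beta> * real (card \<Omega>)"
    and R: "0 \<le> R" "0 \<le> \<alpha>" "R * \<beta> < 3 / 4 * \<alpha>"
  obtains \<Omega>' where "\<Omega>' \<subseteq> \<Omega>" "card U \<le> 4 * card (\<Union>(C ` \<Omega>'))"
    "R * (\<Sum>\<omega>\<in>\<Omega>'. w \<omega>) * real (card U) \<le> real (card (\<Union>(C ` \<Omega>')))"
proof -
  let ?cov = "\<lambda>\<Omega>'. \<Union>(C ` \<Omega>')"
  define G where "G = {\<Omega>'. \<Omega>' \<subseteq> \<Omega> \<and> R * (\<Sum>\<omega>\<in>\<Omega>'. w \<omega>) * real (card U) \<le> real (card (?cov \<Omega>'))}"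
  have "{} \<in> G" by (simp add: G_def)
  moreover have fG: "finite G" using fin(1) by (auto simp: G_def)
  ultimately have "Max ((\<lambda>\<Omega>'. card (?cov \<Omega>')) ` G) \<in> (\<lambda>\<Omega>'. card (?cov \<Omega>')) ` G" by (intro Max_in) auto
  then obtain \<Omega>' where O: "\<Omega>' \<in> G" and "Max ((\<lambda>\<Omega>'. card (?cov \<Omega>')) ` G) = card (?cov \<Omega>')" by auto
  then have max: "card (?cov \<Omega>'') \<le> card (?cov \<Omega>')" if "\<Omega>'' \<in> G" for \<Omega>''
    using that fG by (metis Max_ge finite_imageI image_eqI)
  have sub: "\<Omega>' \<subseteq> \<Omega>" and covU: "?cov \<Omega>' \<subseteq> U" using O C by (auto simp: G_def)
  have "card U \<le> 4 * card (?cov \<Omega>')"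
  proof (rule ccontr)
    assume "\<not> ?thesis"
    then have small: "real (card (?cov \<Omega>')) < real (card U) / 4" by simp
    have cn: "real (card \<Omega>) > 0" "real (card U) > 0" using fin by (auto simp: card_gt_0_iff)
    have "(\<Sum>\<omega>\<in>\<Omega>. R * w \<omega> * real (card U)) = R * real (card U) * (\<Sum>\<omega>\<in>\<Omega>. w \<omega>)"
      by (simp only: sum_distrib_left[symmetric] sum_distrib_right[symmetric] mult_ac)
    also have "\<dots> \<le> R * real (card U) * (\<beta> * real (card \<Omega>))" using cheap R by (intro mult_left_mono) auto
    also have "\<dots> = R * \<beta> * (real (card U) * real (card \<Omega>))" by simp
    also have "\<dots> < 3 / 4 * \<alpha> * (real (card U) * real (card \<Omega>))" using R(3) cn by (intro mult_strict_right_mono) auto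
    also have "\<dots> = real (card U) * 3 / 4 * (\<alpha> * real (card \<Omega>))" by simp
    also have "\<dots> \<le> real (card (U - ?cov \<Omega>')) * (\<alpha> * real (card \<Omega>))"
    proof (intro mult_right_mono)
      have "real (card (U - ?cov \<Omega>')) = real (card U) - real (card (?cov \<Omega>'))"
        using covU fin(2) by (simp add: card_Diff_subset finite_subset card_mono of_nat_diff)
      then show "real (card U) * 3 / 4 \<le> real (card (U - ?cov \<Omega>'))" using small by simp
    qed (use R(2) in auto)
    also have "\<dots> = (\<Sum>A\<in>U - ?cov \<Omega>'. \<alpha> * real (card \<Omega>))" by simp
    also have "\<dots> \<le> (\<Sum>A\<in>U - ?cov \<Omega>'. real (card {\<omega> \<in> \<Omega>. A \<in> C \<omega>}))" using often by (intro sum_mono) auto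
    also have "\<dots> = (\<Sum>A\<in>U - ?cov \<Omega>'. \<Sum>\<omega>\<in>\<Omega>. if A \<in> C \<omega> then 1 else 0)"
      unfolding sum.inter_filter[OF fin(1), symmetric] by simp
    also have "\<dots> = (\<Sum>\<omega>\<in>\<Omega>. \<Sum>A\<in>U - ?cov \<Omega>'. if A \<in> C \<omega> then 1 else 0)" by (rule sum.swap)
    also have "\<dots> = (\<Sum>\<omega>\<in>\<Omega>. real (card (C \<omega> - ?cov \<Omega>')))"
    proof (intro sum.cong refl)
      fix \<omega> assume "\<omega> \<in> \<Omega>"
      then have "{A \<in> U - ?cov \<Omega>'. A \<in> C \<omega>} = C \<omega> - ?cov \<Omega>'" using C by auto
      then show "(\<Sum>A\<in>U - ?cov \<Omega>'. if A \<in> C \<omega> then 1 else 0) = real (card (C \<omega> - ?cov \<Omega>'))"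
        using sum.inter_filter[of "U - ?cov \<Omega>'" "\<lambda>_. 1 :: real" "\<lambda>A. A \<in> C \<omega>"] fin(2) by simp
    qed
    finally have less: "(\<Sum>\<omega>\<in>\<Omega>. R * w \<omega> * real (card U)) < (\<Sum>\<omega>\<in>\<Omega>. real (card (C \<omega> - ?cov \<Omega>')))" .
    have "\<exists>\<omega>\<in>\<Omega>. R * w \<omega> * real (card U) < real (card (C \<omega> - ?cov \<Omega>'))"
    proof (rule ccontr)
      assume "\<not> ?thesis"
      then have "(\<Sum>\<omega>\<in>\<Omega>. real (card (C \<omega> - ?cov \<Omega>'))) \<le> (\<Sum>\<omega>\<in>\<Omega>. R * w \<omega> * real (card U))"
        by (intro sum_mono) (simp add: not_less)
      then show False using less by linarith
    qed
    then obtain \<omega> where \<omega>: "\<omega> \<in> \<Omega>" "R * w \<omega> * real (card U) < real (card (C \<omega> - ?cov \<Omega>'))" by blast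
    have pos: "0 < card (C \<omega> - ?cov \<Omega>')"
    proof -
      have "0 \<le> R * w \<omega> * real (card U)" using w[OF \<omega>(1)] R(1) by simp
      also have "\<dots> < real (card (C \<omega> - ?cov \<Omega>'))" by (rule \<omega>(2))
      finally show ?thesis by (simp only: of_nat_0_less_iff)
    qed
    have new: "\<omega> \<notin> \<Omega>'"
    proof
      assume "\<omega> \<in> \<Omega>'"
      then have "C \<omega> - ?cov \<Omega>' = {}" by blast
      then show False using pos by (metis card.empty less_irrefl)
    qed
    have fc: "finite (?cov \<Omega>')" "finite (C \<omega>)" using covU C[OF \<omega>(1)] fin(2) finite_subset by auto
    have "?cov (insert \<omega> \<Omega>') = ?cov \<Omega>' \<union> (C \<omega> - ?cov \<Omega>')" by auto
    then have cc: "card (?cov (insert \<omega> \<Omega>')) = card (?cov \<Omega>') + card (C \<omega> - ?cov \<Omega>')"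
      using fc by (simp only:) (intro card_Un_disjoint, auto)
    have "R * (\<Sum>\<omega>\<in>insert \<omega> \<Omega>'. w \<omega>) * real (card U) = R * (\<Sum>\<omega>\<in>\<Omega>'. w \<omega>) * real (card U) + R * w \<omega> * real (card U)"
      using new finite_subset[OF sub fin(1)] by (simp add: algebra_simps)
    also have "\<dots> \<le> real (card (?cov (insert \<omega> \<Omega>')))" using O \<omega>(2) unfolding cc by (simp add: G_def)
    finally have "insert \<omega> \<Omega>' \<in> G" using sub \<omega>(1) by (simp add: G_def)
    from max[OF this] show False using cc pos by simp
  qed
  then show ?thesis using that[of \<Omega>'] O sub by (simp add: G_def)
qed

text \<open>
The map \<open>(U, l)\<close> with \<open>U = P + A l\<close>, given by its rows, so that \<open>U - A l\<close> has the rows \<open>P\<close>.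
\<close>

definition lift :: "'k set \<Rightarrow> ('j \<Rightarrow> 'k \<Rightarrow> 'a) \<Rightarrow> ('j \<Rightarrow> 'a ^ 'n) \<Rightarrow> ('k \<Rightarrow> 'a ^ 'n) \<Rightarrow> 'j + 'k \<Rightarrow> 'a::comm_ring_1 ^ 'n" where
  "lift K A P l = (\<lambda>i. case i of Inl j \<Rightarrow> P j + (\<Sum>i\<in>K. A j i *s l i) | Inr i \<Rightarrow> l i)"

lemma lift_mem: "l \<in> PiE K (\<lambda>_. UNIV) \<Longrightarrow> lift K A P l \<in> PiE (UNIV <+> K) (\<lambda>_. UNIV)"
  by (auto simp: lift_def PiE_iff extensional_def split: sum.split)

lemma lift_inj:
  assumes "lift K A P l = lift K A P' l'" shows "P = P' \<and> l = l'"
proof -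
  have l: "l = l'" using fun_cong[OF assms, of "Inr _"] by (auto simp: lift_def)
  moreover have "P j = P' j" for j using fun_cong[OF assms, of "Inl j"] l by (simp add: lift_def)
  ultimately show ?thesis by auto
qed

lemma graph_pt_inj: "graph_pt K y A t = graph_pt K y' A t' \<longleftrightarrow> y = y' \<and> t = t'"
proof
  assume eq: "graph_pt K y A t = graph_pt K y' A t'"
  have t: "t = t'" using fun_cong[OF eq, of "Inr _"] by (auto simp: graph_pt_def)
  moreover have "y j = y' j" for j using fun_cong[OF eq, of "Inl j"] t by (simp add: graph_pt_def)
  ultimately show "y = y' \<and> t = t'" by auto
qed auto

text \<open>
A point has image \<open>y\<close> under the map with rows \<open>P\<close> exactly when \<open>lift K A P l\<close> sends it to the graph
over \<open>y\<close>, the argument on the graph being its image under \<open>l\<close>.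
\<close>

lemma hash_lift:
  "hash (UNIV <+> K) (lift K A P l) x = graph_pt K (\<lambda>j. ip (P j) x) A (hash K l x)"
proof
  fix i
  show "hash (UNIV <+> K) (lift K A P l) x i = graph_pt K (\<lambda>j. ip (P j) x) A (hash K l x) i"
    by (cases i) (auto simp: hash_def lift_def graph_pt_def ip_add ip_sum ip_scale)
qed

text \<open>
For fixed \<open>A\<close> the pairs \<open>(P, l)\<close> correspond bijectively to the maps \<open>\<omega>\<close> from \<open>F ^ n\<close> to \<open>F ^ m\<close>, so that every \<open>A\<close> sees the
same, uniform \<open>\<omega>\<close>. If the unbalanced \<open>P\<close> have proportion \<open>\<delta>\<close>, then each \<open>A\<close> belongs to \<open>C \<omega>\<close> for the proportion
\<open>7 / 9 * \<delta>\<close> of all \<open>\<omega>\<close>, while the sets \<open>B \<omega>\<close> have mean density at most \<open>\<delta> / 36\<close>. Since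
\<open>20 * (1 / 36) < 3 / 4 * (7 / 9)\<close>, a greedy family violates \<open>graph_kakeya\<close>.
\<close>

lemma few_unbalanced_maps:
  fixes S :: "('a::{field,finite} ^ 'n) set" and K :: "'k set"
  assumes K: "finite K" and m: "m = CARD('b::finite) + card K"
    and large: "16 * m * CARD('a) \<le> CARD('a) ^ card K"
    and S: "S \<noteq> {}" and \<tau>: "0 < \<tau>" "\<tau> \<le> 1" and \<delta>: "0 < \<delta>" "\<delta> \<le> 1"
    and big: "144 * real CARD('a) ^ m \<le> \<tau>\<^sup>2 * \<delta> * real (card S)"
  shows "real (card {P :: 'b \<Rightarrow> 'a ^ 'n. \<not> balanced \<tau> S (\<lambda>x. \<chi> j. ip (P j) x)})
    < \<delta> * real CARD('b \<Rightarrow> 'a ^ 'n)"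
proof (rule ccontr)
  define bad where "bad = {P :: 'b \<Rightarrow> 'a ^ 'n. \<not> balanced \<tau> S (\<lambda>x. \<chi> j. ip (P j) x)}"
  assume "\<not> ?thesis"
  then have many: "\<delta> * real CARD('b \<Rightarrow> 'a ^ 'n) \<le> real (card bad)" by (simp add: bad_def)
  define q where "q = real CARD('a)"
  define k where "k = card K"
  define I where "I = (UNIV :: 'b set) <+> K"
  define \<Omega> where "\<Omega> = PiE I (\<lambda>_. UNIV :: ('a ^ 'n) set)"
  define \<Lambda> where "\<Lambda> = PiE K (\<lambda>_. UNIV :: ('a ^ 'n) set)"
  define Z where "Z = PiE I (\<lambda>_. UNIV :: 'a set)"
  define Y where "Y = PiE K (\<lambda>_. UNIV :: 'a set)"
  define U where "U = PiE (UNIV :: 'b set) (\<lambda>_. Y)"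
  define \<mu> where "\<mu> = real (card S) / q ^ m"
  define c where "c \<omega> z = real (card {x \<in> S. hash I \<omega> x = z})" for \<omega> :: "'b + 'k \<Rightarrow> 'a ^ 'n" and z
  define B where "B \<omega> = {z \<in> Z. \<tau> * \<mu> / 2 \<le> \<bar>c \<omega> z - \<mu>\<bar>}" for \<omega>
  define C where "C \<omega> = {A \<in> U. \<exists>y. CARD('a) ^ k \<le> 2 * card {t \<in> Y. graph_pt K y A t \<in> B \<omega>}}" for \<omega>
  have I: "finite I" using K by (simp add: I_def)
  have cI: "card I = m" using K by (simp add: I_def m card_Plus)
  have f\<Omega>: "finite \<Omega>" unfolding \<Omega>_def using I by (intro finite_PiE) auto
  have f\<Lambda>: "finite \<Lambda>" unfolding \<Lambda>_def using K by (intro finite_PiE) auto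
  have fZ: "finite Z" unfolding Z_def using I by (intro finite_PiE) auto
  have fY: "finite Y" unfolding Y_def using K by (intro finite_PiE) auto
  have fU: "finite U" unfolding U_def using fY by (intro finite_PiE) auto
  have cU: "card U = CARD('a) ^ (k * CARD('b))"
    by (simp add: U_def Y_def card_PiE K k_def power_mult)
  have q: "q > 0" by (simp add: q_def)
  have Spos: "real (card S) > 0" using S by (simp add: card_gt_0_iff)
  have \<mu>: "\<mu> > 0" using Spos q by (simp add: \<mu>_def)
  have \<mu>big: "144 \<le> \<tau>\<^sup>2 * \<delta> * \<mu>" using big q unfolding \<mu>_def q_def[symmetric] by (simp add: field_simps)
  have \<mu>big': "144 \<le> \<tau>\<^sup>2 * \<mu>"
  proof -
    have "\<tau>\<^sup>2 * \<delta> * \<mu> \<le> \<tau>\<^sup>2 * 1 * \<mu>" using \<delta> \<mu> by (intro mult_right_mono mult_left_mono) auto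
    then show ?thesis using \<mu>big by simp
  qed
  have "PiE I (\<lambda>_. UNIV :: ('a ^ 'n) set) \<noteq> {}" by (simp add: PiE_eq_empty_iff)
  then have \<Omega>0: "\<Omega> \<noteq> {}" by (simp add: \<Omega>_def)
  have U0: "U \<noteq> {}" by (simp add: U_def Y_def PiE_eq_empty_iff)

  have cheap: "(\<Sum>\<omega>\<in>\<Omega>. real (card (B \<omega>)) / q ^ m) \<le> \<delta> / 36 * real (card \<Omega>)"
  proof -
    have s0: "\<tau> * \<mu> / 2 > 0" using \<tau> \<mu> by simp
    have "(\<Sum>\<omega>\<in>\<Omega>. real (card (B \<omega>))) * (\<tau> * \<mu> / 2)\<^sup>2 \<le> real (card \<Omega>) * real (card S)"
      using hash_chebyshev[OF I s0, of S] unfolding B_def c_def \<Omega>_def Z_def \<mu>_def q_def cI .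
    also have "\<dots> = real (card \<Omega>) * (\<mu> * q ^ m)" using q by (simp add: \<mu>_def)
    also have "\<dots> \<le> real (card \<Omega>) * (\<mu> * q ^ m) * (\<tau>\<^sup>2 * \<delta> * \<mu> / 144)"
      using mult_left_mono[of 1 "\<tau>\<^sup>2 * \<delta> * \<mu> / 144" "real (card \<Omega>) * (\<mu> * q ^ m)"] \<mu>big \<mu> q by simp
    also have "\<dots> = \<delta> / 36 * real (card \<Omega>) * q ^ m * (\<tau> * \<mu> / 2)\<^sup>2"
      by (simp add: power2_eq_square)
    finally have "(\<Sum>\<omega>\<in>\<Omega>. real (card (B \<omega>))) \<le> \<delta> / 36 * real (card \<Omega>) * q ^ m"
      by (rule mult_right_le_imp_le) (use \<tau> \<mu> in simp)
    then have "(\<Sum>\<omega>\<in>\<Omega>. real (card (B \<omega>))) / q ^ m \<le> \<delta> / 36 * real (card \<Omega>)"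
      using q by (simp add: divide_le_eq)
    then show ?thesis by (simp add: sum_divide_distrib)
  qed

  have fine: "7 / 9 * real (card \<Lambda>) \<le> real (card {l \<in> \<Lambda>. A \<in> C (lift K A P l)})"
    if P: "P \<in> bad" and A: "A \<in> U" for A P
  proof -
    obtain y where y: "\<not> ((1 - \<tau>) * \<mu>' \<le> real (card (S \<inter> (\<lambda>x. \<chi> j. ip (P j) x) -` {y})) \<and>
        real (card (S \<inter> (\<lambda>x. \<chi> j. ip (P j) x) -` {y})) \<le> (1 + \<tau>) * \<mu>')"
      if "\<mu>' = real (card S) / q ^ CARD('b)" for \<mu>'
      using P unfolding bad_def balanced_def q_def by (auto simp: Let_def)
    define T where "T = {x \<in> S. \<forall>j. ip (P j) x = y $ j}"
    have T: "S \<inter> (\<lambda>x. \<chi> j. ip (P j) x) -` {y} = T" by (auto simp: T_def vec_eq_iff)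
    define \<nu> where "\<nu> = real (card T) / q ^ k"
    have "real (card S) / q ^ CARD('b) = \<mu> * q ^ k"
      using q by (simp add: \<mu>_def m k_def power_add)
    from y[OF this[symmetric]] have dev: "\<nu> < (1 - \<tau>) * \<mu> \<or> (1 + \<tau>) * \<mu> < \<nu>"
      using q unfolding T \<nu>_def by (auto simp: field_simps)
    \<comment> \<open>a tolerance wide enough for Chebyshev, yet keeping pieces near their mean \<open>\<nu>\<close> away from \<open>\<mu>\<close>\<close>
    obtain s where s: "s > 0" "9 * \<nu> \<le> s\<^sup>2" and
      close: "\<And>u. \<bar>u - \<nu>\<bar> < s \<Longrightarrow> \<tau> * \<mu> / 2 \<le> \<bar>u - \<mu>\<bar>"
    proof (cases "(1 + \<tau>) * \<mu> < \<nu>")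
      case True
      have \<nu>\<mu>: "\<mu> < \<nu>" using True \<tau> \<mu> by (simp add: distrib_right) (smt (verit) mult_pos_pos)
      show ?thesis
      proof (rule that[of "\<nu> * \<tau> / 4"])
        show "\<nu> * \<tau> / 4 > 0" using \<nu>\<mu> \<mu> \<tau> by simp
        have "144 \<le> \<tau>\<^sup>2 * \<nu>" using \<mu>big' \<nu>\<mu> \<tau> by (smt (verit) mult_left_mono zero_le_power2)
        then have "144 * \<nu> \<le> \<tau>\<^sup>2 * \<nu> * \<nu>" using \<nu>\<mu> \<mu> by (intro mult_right_mono) auto
        then show "9 * \<nu> \<le> (\<nu> * \<tau> / 4)\<^sup>2" by (simp add: power2_eq_square mult_ac)
        fix u assume u: "\<bar>u - \<nu>\<bar> < \<nu> * \<tau> / 4"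
        have "(1 + \<tau> / 2) * \<mu> \<le> (1 - \<tau> / 4) * ((1 + \<tau>) * \<mu>)"
        proof -
          have "1 + \<tau> / 2 \<le> (1 - \<tau> / 4) * (1 + \<tau>)"
          proof -
            have "\<tau> * \<tau> \<le> \<tau>" using \<tau> by (simp add: mult_left_le)
            moreover have "(1 - \<tau> / 4) * (1 + \<tau>) = 1 + 3 / 4 * \<tau> - \<tau> * \<tau> / 4"
              by (simp add: field_simps)
            ultimately show ?thesis by linarith
          qed
          then show ?thesis using \<mu> mult_right_mono[of "1 + \<tau> / 2" "(1 - \<tau> / 4) * (1 + \<tau>)" \<mu>]
            by (simp add: mult.assoc)
        qed
        also have "\<dots> \<le> (1 - \<tau> / 4) * \<nu>" using True \<tau> by (intro mult_left_mono) auto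
        also have "\<dots> = \<nu> - \<nu> * \<tau> / 4" by (simp add: algebra_simps)
        also have "\<dots> \<le> u" using u by linarith
        finally have "\<tau> * \<mu> / 2 \<le> u - \<mu>" by (simp add: algebra_simps)
        then show "\<tau> * \<mu> / 2 \<le> \<bar>u - \<mu>\<bar>" by linarith
      qed
    next
      case False
      then have lt: "\<nu> < (1 - \<tau>) * \<mu>" using dev by simp
      show ?thesis
      proof (rule that[of "\<tau> * \<mu> / 2"])
        show "\<tau> * \<mu> / 2 > 0" using \<tau> \<mu> by simp
        have "\<nu> \<le> \<mu>" using lt \<tau> \<mu> by (smt (verit) mult_le_cancel_right1)
        moreover have "144 * \<mu> \<le> \<tau>\<^sup>2 * \<mu> * \<mu>" using \<mu>big' \<mu> by (intro mult_right_mono) auto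
        ultimately have "36 * \<nu> \<le> \<tau>\<^sup>2 * \<mu> * \<mu>" using \<mu> by linarith
        moreover have "(\<tau> * \<mu> / 2)\<^sup>2 = \<tau>\<^sup>2 * \<mu> * \<mu> / 4" by (simp add: power2_eq_square)
        ultimately show "9 * \<nu> \<le> (\<tau> * \<mu> / 2)\<^sup>2" by linarith
        fix u assume "\<bar>u - \<nu>\<bar> < \<tau> * \<mu> / 2"
        then have "u < (1 - \<tau>) * \<mu> + \<tau> * \<mu> / 2" using lt by linarith
        then have "\<tau> * \<mu> / 2 \<le> \<mu> - u" by (simp add: algebra_simps)
        then show "\<tau> * \<mu> / 2 \<le> \<bar>u - \<mu>\<bar>" by linarith
      qed
    qed
    have "9 * real (card T) \<le> s\<^sup>2 * q ^ k"
      using s(2) q by (simp add: \<nu>_def divide_le_eq)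
    then have "7 / 9 * real (card \<Lambda>) \<le> real (card {l \<in> \<Lambda>. CARD('a) ^ k \<le>
        2 * card {t \<in> Y. \<bar>real (card {x \<in> T. hash K l x = t}) - \<nu>\<bar> < s}})"
      using most_hashes_spread[OF K s(1), of T] unfolding \<Lambda>_def Y_def \<nu>_def q_def k_def by simp
    also have "\<dots> \<le> real (card {l \<in> \<Lambda>. A \<in> C (lift K A P l)})"
    proof (intro of_nat_mono card_mono subsetI)
      show "finite {l \<in> \<Lambda>. A \<in> C (lift K A P l)}" using f\<Lambda> by simp
      fix l assume l: "l \<in> {l \<in> \<Lambda>. CARD('a) ^ k \<le>
        2 * card {t \<in> Y. \<bar>real (card {x \<in> T. hash K l x = t}) - \<nu>\<bar> < s}}"
      have "{t \<in> Y. \<bar>real (card {x \<in> T. hash K l x = t}) - \<nu>\<bar> < s}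
          \<subseteq> {t \<in> Y. graph_pt K (\<lambda>j. y $ j) A t \<in> B (lift K A P l)}"
      proof
        fix t assume t: "t \<in> {t \<in> Y. \<bar>real (card {x \<in> T. hash K l x = t}) - \<nu>\<bar> < s}"
        have "{x \<in> S. hash I (lift K A P l) x = graph_pt K (\<lambda>j. y $ j) A t} = {x \<in> T. hash K l x = t}"
          unfolding I_def hash_lift graph_pt_inj T_def fun_eq_iff[of "\<lambda>j. ip (P j) _"] by auto
        then have "c (lift K A P l) (graph_pt K (\<lambda>j. y $ j) A t) = real (card {x \<in> T. hash K l x = t})"
          by (simp add: c_def)
        then show "t \<in> {t \<in> Y. graph_pt K (\<lambda>j. y $ j) A t \<in> B (lift K A P l)}"
          using t close[of "real (card {x \<in> T. hash K l x = t})"] graph_pt_mem[of t K "\<lambda>j. y $ j" A]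
          by (auto simp: B_def Y_def Z_def I_def)
      qed
      then have "card {t \<in> Y. \<bar>real (card {x \<in> T. hash K l x = t}) - \<nu>\<bar> < s}
          \<le> card {t \<in> Y. graph_pt K (\<lambda>j. y $ j) A t \<in> B (lift K A P l)}"
        using fY by (intro card_mono) auto
      then have "CARD('a) ^ k \<le> 2 * card {t \<in> Y. graph_pt K (\<lambda>j. y $ j) A t \<in> B (lift K A P l)}"
        using l by simp
      then show "l \<in> {l \<in> \<Lambda>. A \<in> C (lift K A P l)}" using l A by (auto simp: C_def)
    qed
    finally show ?thesis .
  qed

  have often: "7 / 9 * \<delta> * real (card \<Omega>) \<le> real (card {\<omega> \<in> \<Omega>. A \<in> C \<omega>})" if A: "A \<in> U" for A
  proof -
    let ?X = "SIGMA P:bad. {l \<in> \<Lambda>. A \<in> C (lift K A P l)}"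
    have "real (card \<Omega>) = real CARD('b \<Rightarrow> 'a ^ 'n) * real (card \<Lambda>)"
      by (simp add: \<Omega>_def \<Lambda>_def card_PiE I K cI m card_fun power_add)
    then have "7 / 9 * \<delta> * real (card \<Omega>) = \<delta> * real CARD('b \<Rightarrow> 'a ^ 'n) * (7 / 9 * real (card \<Lambda>))" by simp
    also have "\<dots> \<le> real (card bad) * (7 / 9 * real (card \<Lambda>))" using many by (intro mult_right_mono) auto
    also have "\<dots> = (\<Sum>P\<in>bad. 7 / 9 * real (card \<Lambda>))" by simp
    also have "\<dots> \<le> (\<Sum>P\<in>bad. real (card {l \<in> \<Lambda>. A \<in> C (lift K A P l)}))"
      using fine A by (intro sum_mono) auto
    also have "\<dots> = real (card ?X)" using f\<Lambda> by (subst card_SigmaI) auto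
    also have "\<dots> = real (card ((\<lambda>(P, l). lift K A P l) ` ?X))"
      by (subst card_image) (auto intro!: inj_onI dest: lift_inj)
    also have "\<dots> \<le> real (card {\<omega> \<in> \<Omega>. A \<in> C \<omega>})"
    proof (intro of_nat_mono card_mono)
      show "finite {\<omega> \<in> \<Omega>. A \<in> C \<omega>}" using f\<Omega> by simp
      show "(\<lambda>(P, l). lift K A P l) ` ?X \<subseteq> {\<omega> \<in> \<Omega>. A \<in> C \<omega>}"
      proof
        fix \<omega> assume "\<omega> \<in> (\<lambda>(P, l). lift K A P l) ` ?X"
        then obtain P l where "\<omega> = lift K A P l" "l \<in> \<Lambda>" "A \<in> C (lift K A P l)" by auto
        then show "\<omega> \<in> {\<omega> \<in> \<Omega>. A \<in> C \<omega>}"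
          using lift_mem[of l K A P] unfolding \<Omega>_def \<Lambda>_def I_def by simp
      qed
    qed
    finally show ?thesis .
  qed

  have CU: "C \<omega> \<subseteq> U" for \<omega> by (auto simp: C_def)
  have w0: "0 \<le> real (card (B \<omega>)) / q ^ m" for \<omega> using q by simp
  obtain \<Omega>' where \<Omega>': "\<Omega>' \<subseteq> \<Omega>" "card U \<le> 4 * card (\<Union>(C ` \<Omega>'))"
    "20 * (\<Sum>\<omega>\<in>\<Omega>'. real (card (B \<omega>)) / q ^ m) * real (card U) \<le> real (card (\<Union>(C ` \<Omega>')))"
    by (rule greedy_cover[OF f\<Omega> fU \<Omega>0 U0 CU w0 often cheap, of 20]) (use \<delta> in auto)
  have CU': "\<Union>(C ` \<Omega>') \<subseteq> U" using CU by blast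
  have f\<Omega>': "finite \<Omega>'" using \<Omega>'(1) f\<Omega> by (rule finite_subset)
  have "4 * card (\<Union>(C ` \<Omega>')) < CARD('a) ^ (card K * CARD('b))"
  proof (rule graph_kakeya[OF K m large, of "\<Union>(B ` \<Omega>')"])
    show "\<Union>(B ` \<Omega>') \<subseteq> PiE (UNIV <+> K) (\<lambda>_. UNIV)" by (auto simp: B_def Z_def I_def)
    show "\<Union>(C ` \<Omega>') \<subseteq> PiE UNIV (\<lambda>_. PiE K (\<lambda>_. UNIV))" using CU' by (simp add: U_def Y_def)
    have "real (card (\<Union>(B ` \<Omega>'))) \<le> (\<Sum>\<omega>\<in>\<Omega>'. real (card (B \<omega>)))"
      using card_UN_le[OF f\<Omega>', of B] by (metis of_nat_mono of_nat_sum)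
    moreover have "20 * (\<Sum>\<omega>\<in>\<Omega>'. real (card (B \<omega>)) / q ^ m) * real (card U) \<le> 1 * real (card U)"
      using \<Omega>'(3) card_mono[OF fU CU'] by simp
    then have "20 * (\<Sum>\<omega>\<in>\<Omega>'. real (card (B \<omega>)) / q ^ m) \<le> 1"
      by (rule mult_right_le_imp_le) (use fU U0 in \<open>simp add: card_gt_0_iff\<close>)
    then have "20 * (\<Sum>\<omega>\<in>\<Omega>'. real (card (B \<omega>))) \<le> q ^ m"
      using q by (simp add: sum_divide_distrib[symmetric] divide_le_eq)
    ultimately have "real (20 * card (\<Union>(B ` \<Omega>'))) \<le> real (CARD('a) ^ m)" by (simp add: q_def)
    then show "20 * card (\<Union>(B ` \<Omega>')) \<le> CARD('a) ^ m" by (simp only: of_nat_le_iff)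
    fix A assume "A \<in> \<Union>(C ` \<Omega>')"
    then obtain \<omega> y where \<omega>: "\<omega> \<in> \<Omega>'" "CARD('a) ^ k \<le> 2 * card {t \<in> Y. graph_pt K y A t \<in> B \<omega>}"
      by (auto simp: C_def)
    have "card {t \<in> Y. graph_pt K y A t \<in> B \<omega>} \<le> card {t \<in> Y. graph_pt K y A t \<in> \<Union>(B ` \<Omega>')}"
      using \<omega>(1) fY by (intro card_mono) auto
    then show "\<exists>y. CARD('a) ^ card K \<le> 2 * card {t \<in> PiE K (\<lambda>_. UNIV). graph_pt K y A t \<in> \<Union>(B ` \<Omega>')}"
      using \<omega>(2) unfolding k_def Y_def by (intro exI[of _ y]) linarith
  qed
  then show False using \<Omega>'(2) by (simp add: cU k_def)
qed

section \<open>The probability of balancedness\<close>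

definition row_map :: "('b \<Rightarrow> 'a::comm_ring_1 ^ 'n) \<Rightarrow> 'a ^ 'n \<Rightarrow> 'a ^ 'b" where
  "row_map P = (\<lambda>x. \<chi> j. ip (P j) x)"

lemma bij_betw_row_map:
  "bij_betw row_map UNIV (linear_maps :: ('a::{field,finite} ^ 'n \<Rightarrow> 'a ^ 'b::finite) set)"
proof -
  have mat: "row_map P = (*v) (\<chi> j. P j)" for P :: "'b \<Rightarrow> 'a ^ 'n"
    by (simp add: row_map_def fun_eq_iff matrix_vector_mult_def ip_def vec_eq_iff)
  show ?thesis
  proof (rule bij_betw_byWitness[where f' = "\<lambda>L j. matrix L $ j"])
    show "\<forall>P\<in>UNIV. (\<lambda>j. matrix (row_map P) $ j) = (P :: 'b \<Rightarrow> 'a ^ 'n)" by (simp add: mat)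
    show "\<forall>L\<in>linear_maps. row_map (\<lambda>j. matrix L $ j) = (L :: 'a ^ 'n \<Rightarrow> 'a ^ 'b)"
      by (auto simp: mat linear_maps_def matrix_works fun_eq_iff)
    show "row_map ` (UNIV :: ('b \<Rightarrow> 'a ^ 'n) set) \<subseteq> linear_maps" by (auto simp: mat linear_maps_def)
  qed auto
qed

lemma balanced_mono:
  assumes "balanced \<tau>' S L" "\<tau>' \<le> \<tau>"
  shows "balanced \<tau> S L"
proof -
  have "(1 - \<tau>) * a \<le> (1 - \<tau>') * a" "(1 + \<tau>') * a \<le> (1 + \<tau>) * a" if "0 \<le> a" for a
    using assms(2) that by (auto intro: mult_right_mono)
  then show ?thesis
    using assms(1) unfolding balanced_def Let_def by (meson order.trans divide_nonneg_nonneg of_nat_0_le_iff zero_le_power)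
qed

lemma balanced_imp_surj:
  assumes "balanced \<tau> S L" "\<tau> < 1" "S \<noteq> {}"
  shows "surj L"
proof -
  have "\<exists>x. L x = y" for y
  proof -
    have "0 < (1 - \<tau>) * (real (card S) / real CARD('a) ^ CARD('c))"
      using assms(2,3) by (simp add: card_gt_0_iff)
    also have "\<dots> \<le> real (card (S \<inter> L -` {y}))"
      using assms(1) by (simp add: balanced_def Let_def)
    finally have "S \<inter> L -` {y} \<noteq> {}" by auto
    then show ?thesis by auto
  qed
  then show ?thesis by (metis surjI)
qed

text \<open>
The ceiling makes \<open>q ^ (k - 1) \<ge> 16 * h\<close> for \<open>k = \<lceil>log q (16 * h)\<rceil> + 1\<close>, and the floor makes
\<open>q ^ (c + k)\<close> at most \<open>\<tau>\<^sup>2 * \<delta> / 192\<close> times \<open>q powr h\<close>; in particular \<open>c + k \<le> h\<close>.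
\<close>

lemma codimension_bounds:
  fixes q h \<tau> \<delta> :: real and b :: int
  assumes q: "q \<ge> 2" and h: "h \<ge> 1" and \<tau>: "0 < \<tau>" "\<tau> \<le> 1" and \<delta>: "0 < \<delta>" "\<delta> < 1"
    and b: "b = \<lfloor>h - 1 - real_of_int \<lceil>log q (16 * h)\<rceil> - log q (192 / (\<tau>\<^sup>2 * \<delta>))\<rfloor>" "int c = b"
  obtains k where "16 * real (c + k) * q \<le> q ^ k" "192 * q ^ (c + k) \<le> \<tau>\<^sup>2 * \<delta> * q powr h"
proof -
  define r where "r = \<lceil>log q (16 * h)\<rceil>"
  have "log q (16 * h) > 0" using q h by simp
  then have r0: "r \<ge> 0" unfolding r_def by linarith
  define k where "k = nat r + 1"
  have kr: "real k = real_of_int r + 1" using r0 by (simp add: k_def)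
  have t: "0 < \<tau>\<^sup>2 * \<delta>" "\<tau>\<^sup>2 * \<delta> \<le> 1"
    using \<tau> \<delta> by (auto simp: power_le_one intro!: mult_le_one)
  have "real_of_int b \<le> h - 1 - real_of_int r - log q (192 / (\<tau>\<^sup>2 * \<delta>))"
    unfolding b(1) r_def by (rule of_int_floor_le)
  moreover have "real_of_int b = real c" using b(2) by (metis of_int_of_nat_eq)
  ultimately have ck: "real (c + k) + log q (192 / (\<tau>\<^sup>2 * \<delta>)) \<le> h" by (simp add: kr)
  have "log q (192 / (\<tau>\<^sup>2 * \<delta>)) > 0"
    using q t by (simp add: divide_simps)
  then have ckh: "real (c + k) \<le> h" using ck by linarith
  show ?thesis
  proof (rule that)
    have "16 * h = q powr (log q (16 * h))" using q h by simp
    also have "\<dots> \<le> q powr (real_of_int r)" using q by (intro powr_mono) (auto simp: r_def)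
    also have "\<dots> = q ^ nat r" using q r0 by (metis of_int_of_nat_eq int_nat_eq powr_realpow zero_less_numeral less_le_trans)
    finally have "16 * h \<le> q ^ nat r" .
    moreover have "16 * real (c + k) \<le> 16 * h" using ckh by simp
    ultimately have "16 * real (c + k) \<le> q ^ nat r" by (rule order.trans[rotated])
    then show "16 * real (c + k) * q \<le> q ^ k" using q by (simp add: k_def mult.commute)
    have "192 / (\<tau>\<^sup>2 * \<delta>) * q ^ (c + k) = q powr (log q (192 / (\<tau>\<^sup>2 * \<delta>))) * q powr real (c + k)"
    proof -
      have "q powr real (c + k) = q ^ (c + k)" using q by (intro powr_realpow) simp
      moreover have "q powr (log q (192 / (\<tau>\<^sup>2 * \<delta>))) = 192 / (\<tau>\<^sup>2 * \<delta>)"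
        using q t by (intro powr_log_cancel) auto
      ultimately show ?thesis by (simp only:)
    qed
    also have "\<dots> = q powr (real (c + k) + log q (192 / (\<tau>\<^sup>2 * \<delta>)))" by (simp add: powr_add mult.commute)
    also have "\<dots> \<le> q powr h" using q ck by (intro powr_mono) auto
    finally show "192 * q ^ (c + k) \<le> \<tau>\<^sup>2 * \<delta> * q powr h"
      using t by (simp add: field_simps)
  qed
qed

theorem corollary1p3:
  fixes S :: "(('a::{field,finite})^'n) set"
    and \<tau> \<delta> q h :: real and b :: int
  assumes "q = real CARD('a)"
    and "S \<noteq> {}"
    and "h = log q (real (card S))" and "h \<ge> 1"
    and "0 < \<tau>" and "\<tau> \<le> 1"
    and "0 < \<delta>" and "\<delta> < 1"
    and "b = \<lfloor>h - 1 - real_of_int \<lceil>log q (16 * h)\<rceil> - log q (192 / (\<tau>\<^sup>2 * \<delta>))\<rfloor>"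
    and "b \<ge> 1"
    and "int CARD('b) = b"
  shows "measure_pmf.prob (pmf_of_set (linear_maps :: ('a^'n \<Rightarrow> 'a^'b::finite) set))
           {L. balanced \<tau> S L} > 1 - \<delta>
       \<and> measure_pmf.prob (pmf_of_set (surjective_linear_maps :: ('a^'n \<Rightarrow> 'a^'b) set))
           {L. balanced \<tau> S L} > 1 - \<delta>"
proof -
  let ?Lin = "linear_maps :: ('a^'n \<Rightarrow> 'a^'b) set"
  let ?Sur = "surjective_linear_maps :: ('a^'n \<Rightarrow> 'a^'b) set"
  have q: "q \<ge> 2"
  proof -
    have "card {0, 1 :: 'a} \<le> CARD('a)" by (rule card_mono) auto
    then show ?thesis using assms(1) by simp
  qed
  have qh: "q powr h = real (card S)"
    using q assms(2,3) by (simp add: card_gt_0_iff)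
  obtain k where k: "16 * real (CARD('b) + k) * q \<le> q ^ k"
    "192 * q ^ (CARD('b) + k) \<le> \<tau>\<^sup>2 * \<delta> * real (card S)"
    using codimension_bounds[OF q assms(4-9) assms(11)] qh by metis
  \<comment> \<open>A parameter below 1 forces surjectivity; \<open>192 * (9 / 10)\<^sup>2 \<ge> 144\<close> pays for the change.\<close>
  define \<tau>' where "\<tau>' = min \<tau> (9 / 10)"
  have \<tau>': "0 < \<tau>'" "\<tau>' < 1" "\<tau>' \<le> \<tau>" using assms(5) by (auto simp: \<tau>'_def)
  have "144 / 192 * \<tau>\<^sup>2 \<le> \<tau>'\<^sup>2"
  proof (cases "\<tau> \<le> 9 / 10")
    case False
    have "\<tau>\<^sup>2 \<le> 1" using assms(5,6) by (simp add: power_le_one)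
    then show ?thesis using False by (simp add: \<tau>'_def power2_eq_square)
  qed (simp add: \<tau>'_def)
  then have "144 / 192 * \<tau>\<^sup>2 * (\<delta> * real (card S)) \<le> \<tau>'\<^sup>2 * (\<delta> * real (card S))"
    using assms(7) by (intro mult_right_mono) auto
  then have big: "144 * real CARD('a) ^ (CARD('b) + card {..<k}) \<le> \<tau>'\<^sup>2 * \<delta> * real (card S)"
    using k(2) assms(1) by (simp add: mult.assoc)
  have "real (16 * (CARD('b) + card {..<k}) * CARD('a)) \<le> real (CARD('a) ^ card {..<k})"
    using k(1) assms(1) by (simp add: algebra_simps)
  then have large: "16 * (CARD('b) + card {..<k}) * CARD('a) \<le> CARD('a) ^ card {..<k}"
    by (simp only: of_nat_le_iff)
  define bal where "bal = {L \<in> ?Lin. balanced \<tau>' S L}"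
  have cLin: "card ?Lin = CARD('b \<Rightarrow> 'a ^ 'n)"
    using bij_betw_same_card[OF bij_betw_row_map] by metis
  have "finite (row_map ` (UNIV :: ('b \<Rightarrow> 'a ^ 'n) set))" by simp
  then have fLin: "finite ?Lin" using bij_betw_row_map by (metis bij_betw_def)
  have "real (card (?Lin - bal)) < \<delta> * real (card ?Lin)"
  proof -
    have "?Lin - bal = row_map ` {P. \<not> balanced \<tau>' S (row_map P)}"
    proof -
      have "?Lin = row_map ` UNIV" using bij_betw_row_map by (metis bij_betw_def)
      then show ?thesis by (auto simp: bal_def)
    qed
    then have "card (?Lin - bal) = card {P :: 'b \<Rightarrow> 'a ^ 'n. \<not> balanced \<tau>' S (row_map P)}"
      using bij_betw_imp_inj_on[OF bij_betw_row_map] by (metis card_image inj_on_subset subset_UNIV)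
    then show ?thesis
      using few_unbalanced_maps[OF finite_lessThan refl large assms(2) \<tau>'(1) _ assms(7) _ big] \<tau>'(2) assms(8)
      by (simp add: row_map_def cLin)
  qed
  moreover have "real (card (?Lin - bal)) = real (card ?Lin) - real (card bal)"
    using fLin by (subst card_Diff_subset) (auto simp: bal_def of_nat_diff card_mono)
  ultimately have bal: "(1 - \<delta>) * real (card ?Lin) < real (card bal)" by (simp add: algebra_simps)
  have prob: "1 - \<delta> < measure_pmf.prob (pmf_of_set M) {L. balanced \<tau> S L}"
    if M: "bal \<subseteq> M" "M \<subseteq> ?Lin" for M
  proof -
    have fM: "finite M" using M(2) fLin by (rule finite_subset)
    have "0 \<le> (1 - \<delta>) * real (card ?Lin)" using assms(8) by simp
    then have "0 < real (card bal)" using bal by linarith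
    then have "bal \<noteq> {}" by auto
    then have M0: "M \<noteq> {}" using M(1) by auto
    then have cM: "0 < real (card M)" using fM by (simp add: card_gt_0_iff)
    have "(1 - \<delta>) * real (card M) \<le> (1 - \<delta>) * real (card ?Lin)"
      using assms(8) card_mono[OF fLin M(2)] by (intro mult_left_mono) auto
    also have "\<dots> < real (card bal)" by (rule bal)
    also have "card bal \<le> card (M \<inter> {L. balanced \<tau> S L})"
      using fM M(1) balanced_mono[OF _ \<tau>'(3)] by (intro card_mono) (auto simp: bal_def)
    finally show ?thesis using cM by (simp add: measure_pmf_of_set[OF M0 fM] pos_less_divide_eq)
  qed
  have "bal \<subseteq> ?Sur"
    using balanced_imp_surj[OF _ \<tau>'(2) assms(2)] by (auto simp: bal_def surjective_linear_maps_def)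
  then show ?thesis
    using prob[of ?Lin] prob[of ?Sur] by (auto simp: bal_def surjective_linear_maps_def)
qed

end
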